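(* Let $\Pi$ be a polar space of rank $n\ge3$ and let $k,l,m$ be natural numbers with $0<m\le k$, $l\le n$ and $l-m=n-k>1$. Let $\mathcal X\subset\mathcal G_k(\Pi)$ be such that the restriction $\Gamma(\mathcal X)$ of $\Gamma_k(\Pi)$ to $\mathcal X$ is isomorphic to $PJ(l,m)$ and every maximal clique of $\Gamma(\mathcal X)$ is an independent subset of $\mathfrak G_k(\Pi)$. Suppose that either (1) $2m+2>l$, or (2) $\mathcal X$ is not contained in any big star $[S\rangle_k$, $S\in\mathcal G_{k-1}(\Pi)$. Then there exists a $(k-m-1)$-dimensional singular subspace $N$ of $\Pi$ such that $\mathcal X$ is an apartment in the parabolic subspace $[N\rangle_k$.
   Context: Polar space $\Pi=(P,\mathcal L)$ of rank $n$: partial linear space with lines of $\ge3$ points, no point collinear with all others, each point collinear with one or all points of a line, finite flags of singular subspaces; maximal singular subspaces are $(n-1)$-dimensional projective spaces. $\mathcal G_j(\Pi)$: set of $j$-dimensional singular subspaces ($\dim\emptyset=-1$). For $j\le n-2$, $S,U\in\mathcal G_j(\Pi)$ are adjacent if $\dim(S\cap U)=j-1$ and every point of $S$ is collinear with every point of $U$; this gives the graph $\Gamma_j(\Pi)$. $[S,U]_j=\{X\in\mathcal G_j(\Pi):S\subset X\subset U\}$, $[S\rangle_j=\{X\in\mathcal G_j(\Pi):S\subset X\}$. The Grassmann space $\mathfrak G_j(\Pi)$ has points $\mathcal G_j(\Pi)$ and lines $[S,U]_j$, $S\in\mathcal G_{j-1}(\Pi)$, $U\in\mathcal G_{j+1}(\Pi)$,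 $S\subset U$. A subset $Z$ of a partial linear space is independent if the subspace spanned by $Z$ (smallest set containing $Z$ closed under lines through two of its collinear points) is not spanned by a proper subset of $Z$. For a $(k-m-1)$-dimensional singular subspace $N$, $[N\rangle_{k-m}$ with lines $[S,U]_{k-m}$ ($N\subset S$) is a polar space of rank $n-k+m$; a frame of it is a set of $2(n-k+m)$ distinct points each non-collinear (in this polar space) with exactly one other point of the set. The parabolic subspace $[N\rangle_k$ is a subspace of $\mathfrak G_k(\Pi)$; an apartment of $[N\rangle_k$ is, for a frame $\mathcal B$ of $[N\rangle_{k-m}$, the set of all elements of $\mathcal G_k(\Pi)$ spanned (as subspaces of $\Pi$) by $m+1$ mutually collinear elements of $\mathcal B$. Polar Johnson graph $PJ(l,m)$: with $J=\{\pm1,\dots,\pm l\}$, singular subsets are those not containing both $j$ and $-j$; vertices are singular $(m+1)$-subsets, adjacent when they share $m$ elements and (if $m\le l-2$) their union is singular. *)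

theory Defs
  imports Main
begin

section \<open>Point-line geometries\<close>

text \<open>
  A geometry is given by a point set \<open>P\<close> and a set \<open>L\<close> of lines, each line being a set of points.
\<close>

definition partial_linear_space :: "'a set \<Rightarrow> 'a set set \<Rightarrow> bool" where
  "partial_linear_space P L \<longleftrightarrow>
     (\<forall>l\<in>L. l \<subseteq> P \<and> (\<exists>p\<in>l. \<exists>q\<in>l. p \<noteq> q)) \<and>
     (\<forall>l\<in>L. \<forall>l'\<in>L. \<forall>p q. p \<noteq> q \<longrightarrow> {p, q} \<subseteq> l \<longrightarrow> {p, q} \<subseteq> l' \<longrightarrow> l = l')"

text \<open>Collinearity is reflexive: a point counts as collinear with itself.\<close>

definition pt_collinear :: "'a set \<Rightarrow> 'a set set \<Rightarrow> 'a \<Rightarrow> 'a \<Rightarrow> bool" where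
  "pt_collinear P L p q \<longleftrightarrow> p \<in> P \<and> q \<in> P \<and> (p = q \<or> (\<exists>l\<in>L. p \<in> l \<and> q \<in> l))"

definition geom_subspace :: "'a set \<Rightarrow> 'a set set \<Rightarrow> 'a set \<Rightarrow> bool" where
  "geom_subspace P L X \<longleftrightarrow>
     X \<subseteq> P \<and> (\<forall>l\<in>L. \<forall>p\<in>X. \<forall>q\<in>X. p \<noteq> q \<longrightarrow> p \<in> l \<longrightarrow> q \<in> l \<longrightarrow> l \<subseteq> X)"

definition geom_span :: "'a set \<Rightarrow> 'a set set \<Rightarrow> 'a set \<Rightarrow> 'a set" where
  "geom_span P L Z = \<Inter>{X. geom_subspace P L X \<and> Z \<subseteq> X}"

definition geom_independent :: "'a set \<Rightarrow> 'a set set \<Rightarrow> 'a set \<Rightarrow> bool" where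
  "geom_independent P L Z \<longleftrightarrow>
     Z \<subseteq> P \<and> \<not> (\<exists>Y. Y \<subset> Z \<and> geom_span P L Y = geom_span P L Z)"

definition singular_subspace :: "'a set \<Rightarrow> 'a set set \<Rightarrow> 'a set \<Rightarrow> bool" where
  "singular_subspace P L S \<longleftrightarrow>
     geom_subspace P L S \<and> (\<forall>p\<in>S. \<forall>q\<in>S. pt_collinear P L p q)"

definition maximal_singular_subspace :: "'a set \<Rightarrow> 'a set set \<Rightarrow> 'a set \<Rightarrow> bool" where
  "maximal_singular_subspace P L M \<longleftrightarrow>
     singular_subspace P L M \<and> (\<forall>S. singular_subspace P L S \<longrightarrow> M \<subseteq> S \<longrightarrow> S = M)"

text \<open>
  Dimension is one less than the size of a base (an independent spanning set), so the empty set
  has dimension \<open>-1\<close>. It is a relation; in a projective space all bases have the same size.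
\<close>

definition has_geom_dim :: "'a set \<Rightarrow> 'a set set \<Rightarrow> 'a set \<Rightarrow> int \<Rightarrow> bool" where
  "has_geom_dim P L S d \<longleftrightarrow>
     (\<exists>B. finite B \<and> geom_independent P L B \<and> geom_span P L B = S \<and> int (card B) = d + 1)"

text \<open>The last conjunct is the Veblen--Young axiom.\<close>

definition projective_space :: "'a set \<Rightarrow> 'a set set \<Rightarrow> bool" where
  "projective_space P L \<longleftrightarrow>
     partial_linear_space P L \<and>
     (\<forall>p\<in>P. \<forall>q\<in>P. pt_collinear P L p q) \<and>
     (\<forall>l\<in>L. \<exists>p\<in>l. \<exists>q\<in>l. \<exists>r\<in>l. p \<noteq> q \<and> p \<noteq> r \<and> q \<noteq> r) \<and>
     (\<forall>a b c d. \<forall>ab\<in>L. \<forall>cd\<in>L. \<forall>ac\<in>L. \<forall>bd\<in>L.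
        distinct [a, b, c, d] \<longrightarrow> {a, b} \<subseteq> ab \<longrightarrow> {c, d} \<subseteq> cd \<longrightarrow> {a, c} \<subseteq> ac \<longrightarrow> {b, d} \<subseteq> bd \<longrightarrow>
        ab \<inter> cd \<noteq> {} \<longrightarrow> ac \<inter> bd \<noteq> {})"

section \<open>Polar spaces\<close>

definition polar_space :: "'a set \<Rightarrow> 'a set set \<Rightarrow> bool" where
  "polar_space P L \<longleftrightarrow>
     partial_linear_space P L \<and>
     (\<forall>l\<in>L. \<exists>p\<in>l. \<exists>q\<in>l. \<exists>r\<in>l. p \<noteq> q \<and> p \<noteq> r \<and> q \<noteq> r) \<and>
     (\<forall>p\<in>P. \<exists>q\<in>P. \<not> pt_collinear P L p q) \<and>
     (\<forall>p\<in>P. \<forall>l\<in>L. (\<exists>!q. q \<in> l \<and> pt_collinear P L p q) \<or> (\<forall>q\<in>l. pt_collinear P L p q)) \<and>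
     (\<forall>F. (\<forall>S\<in>F. singular_subspace P L S) \<and> (\<forall>S\<in>F. \<forall>T\<in>F. S \<subseteq> T \<or> T \<subseteq> S) \<longrightarrow> finite F)"

definition polar_space_of_rank :: "'a set \<Rightarrow> 'a set set \<Rightarrow> nat \<Rightarrow> bool" where
  "polar_space_of_rank P L n \<longleftrightarrow>
     polar_space P L \<and>
     (\<forall>M. maximal_singular_subspace P L M \<longrightarrow>
        projective_space M {l \<in> L. l \<subseteq> M} \<and> has_geom_dim P L M (int n - 1))"

section \<open>Polar Grassmannians\<close>

definition polar_grass :: "'a set \<Rightarrow> 'a set set \<Rightarrow> int \<Rightarrow> 'a set set" where
  "polar_grass P L j = {S. singular_subspace P L S \<and> has_geom_dim P L S j}"

text \<open>Adjacency in the graph on \<open>polar_grass P L j\<close>; intended for \<open>j \<le> n - 2\<close>, \<open>n\<close> the rank.\<close>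

definition grass_adj :: "'a set \<Rightarrow> 'a set set \<Rightarrow> int \<Rightarrow> 'a set \<Rightarrow> 'a set \<Rightarrow> bool" where
  "grass_adj P L j S U \<longleftrightarrow>
     S \<in> polar_grass P L j \<and> U \<in> polar_grass P L j \<and>
     has_geom_dim P L (S \<inter> U) (j - 1) \<and> (\<forall>p\<in>S. \<forall>q\<in>U. pt_collinear P L p q)"

definition grass_interval :: "'a set \<Rightarrow> 'a set set \<Rightarrow> int \<Rightarrow> 'a set \<Rightarrow> 'a set \<Rightarrow> 'a set set" where
  "grass_interval P L j S U = {X \<in> polar_grass P L j. S \<subseteq> X \<and> X \<subseteq> U}"

definition grass_star :: "'a set \<Rightarrow> 'a set set \<Rightarrow> int \<Rightarrow> 'a set \<Rightarrow> 'a set set" where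
  "grass_star P L j S = {X \<in> polar_grass P L j. S \<subseteq> X}"

text \<open>The Grassmann space of index \<open>j\<close> is the geometry \<open>(polar_grass P L j, grass_lines P L j)\<close>.\<close>

definition grass_lines :: "'a set \<Rightarrow> 'a set set \<Rightarrow> int \<Rightarrow> 'a set set set" where
  "grass_lines P L j =
     {grass_interval P L j S U | S U.
        S \<in> polar_grass P L (j - 1) \<and> U \<in> polar_grass P L (j + 1) \<and> S \<subseteq> U}"

text \<open>
  The lines of the geometry on \<open>grass_star P L j N\<close>. When \<open>N\<close> has dimension \<open>j - 1\<close>,
  necessarily \<open>S = N\<close>.
\<close>

definition star_lines :: "'a set \<Rightarrow> 'a set set \<Rightarrow> int \<Rightarrow> 'a set \<Rightarrow> 'a set set set" where
  "star_lines P L j N =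
     {grass_interval P L j S U | S U.
        S \<in> polar_grass P L (j - 1) \<and> U \<in> polar_grass P L (j + 1) \<and> N \<subseteq> S \<and> S \<subseteq> U}"

section \<open>Frames and apartments\<close>

text \<open>\<open>polar_frame P L r B\<close>: \<open>B\<close> is a frame of a polar space \<open>(P, L)\<close> of rank \<open>r\<close>.\<close>

definition polar_frame :: "'a set \<Rightarrow> 'a set set \<Rightarrow> nat \<Rightarrow> 'a set \<Rightarrow> bool" where
  "polar_frame P L r B \<longleftrightarrow>
     B \<subseteq> P \<and> finite B \<and> card B = 2 * r \<and>
     (\<forall>p\<in>B. \<exists>!q. q \<in> B \<and> q \<noteq> p \<and> \<not> pt_collinear P L p q)"

text \<open>
  \<open>parabolic_apartment P L n k m N X\<close>: in the polar space \<open>(P, L)\<close> of rank \<open>n \<ge> k\<close>, \<open>X\<close> is an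
  apartment of \<open>grass_star P L k N\<close>, where \<open>N\<close> is singular of dimension \<open>k - m - 1\<close>. The elements
  of the frame \<open>B\<close> are themselves \<open>(k - m)\<close>-dimensional singular subspaces of \<open>(P, L)\<close>, and
  their collinearity is that of the polar space of rank \<open>n - k + m\<close> formed by
  \<open>grass_star P L (k - m) N\<close>.
\<close>

definition parabolic_apartment ::
  "'a set \<Rightarrow> 'a set set \<Rightarrow> nat \<Rightarrow> nat \<Rightarrow> nat \<Rightarrow> 'a set \<Rightarrow> 'a set set \<Rightarrow> bool" where
  "parabolic_apartment P L n k m N X \<longleftrightarrow>
     (let j = int k - int m; Q = grass_star P L j N; R = star_lines P L j N in
      \<exists>B. polar_frame Q R (n - k + m) B \<and>
          X = {Y \<in> polar_grass P L (int k).
                 \<exists>C. C \<subseteq> B \<and> card C = m + 1 \<and>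
                     (\<forall>S\<in>C. \<forall>T\<in>C. pt_collinear Q R S T) \<and> Y = geom_span P L (\<Union>C)})"

section \<open>Graphs\<close>

text \<open>A graph is a vertex set with an adjacency relation, considered only on that vertex set.\<close>

definition graph_isomorphic ::
  "'a set \<Rightarrow> ('a \<Rightarrow> 'a \<Rightarrow> bool) \<Rightarrow> 'b set \<Rightarrow> ('b \<Rightarrow> 'b \<Rightarrow> bool) \<Rightarrow> bool" where
  "graph_isomorphic V E W F \<longleftrightarrow>
     (\<exists>f. bij_betw f V W \<and> (\<forall>x\<in>V. \<forall>y\<in>V. E x y \<longleftrightarrow> F (f x) (f y)))"

definition graph_clique :: "'a set \<Rightarrow> ('a \<Rightarrow> 'a \<Rightarrow> bool) \<Rightarrow> 'a set \<Rightarrow> bool" where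
  "graph_clique V E C \<longleftrightarrow> C \<subseteq> V \<and> (\<forall>x\<in>C. \<forall>y\<in>C. x \<noteq> y \<longrightarrow> E x y)"

definition maximal_clique :: "'a set \<Rightarrow> ('a \<Rightarrow> 'a \<Rightarrow> bool) \<Rightarrow> 'a set \<Rightarrow> bool" where
  "maximal_clique V E C \<longleftrightarrow>
     graph_clique V E C \<and> (\<forall>D. graph_clique V E D \<longrightarrow> C \<subseteq> D \<longrightarrow> D = C)"

definition PJ_singular :: "nat \<Rightarrow> int set \<Rightarrow> bool" where
  "PJ_singular l A \<longleftrightarrow>
     A \<subseteq> {j. 1 \<le> \<bar>j\<bar> \<and> \<bar>j\<bar> \<le> int l} \<and> \<not> (\<exists>j. j \<in> A \<and> - j \<in> A)"

definition PJ_vertices :: "nat \<Rightarrow> nat \<Rightarrow> int set set" where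
  "PJ_vertices l m = {A. PJ_singular l A \<and> card A = m + 1}"

definition PJ_adj :: "nat \<Rightarrow> nat \<Rightarrow> int set \<Rightarrow> int set \<Rightarrow> bool" where
  "PJ_adj l m A B \<longleftrightarrow>
     A \<in> PJ_vertices l m \<and> B \<in> PJ_vertices l m \<and>
     card (A \<inter> B) = m \<and> (m + 2 \<le> l \<longrightarrow> PJ_singular l (A \<union> B))"

end

theory Submission
  imports Defs
begin

text \<open>
  Let \<open>f\<close> be the inverse of the given isomorphism, from the singular \<open>(m + 1)\<close>-sets onto \<open>X\<close>. A
  singular \<open>(m + 2)\<close>-set \<open>D\<close> yields a maximal clique \<open>f (D - {x})\<close>, \<open>x \<in> D\<close>, whose members lie in a
  common \<open>(k + 1)\<close>-dimensional singular subspace or contain a common \<open>(k - 1)\<close>-dimensional one.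
  The second case is excluded: by counting if \<open>2 * m + 2 > l\<close>, since an independent clique with a
  common \<open>(k - 1)\<close>-dimensional subspace has at most \<open>n - k = l - m\<close> elements, and otherwise because the
  common subspace would spread to all of \<open>X\<close>. The only exception is \<open>l = 4\<close>, \<open>m = 1\<close>: here the polar
  Johnson graph is the graph of the 24-cell, which has additional automorphisms, and \<open>f\<close> has to be
  composed with one of them.

  In the first case the \<open>f (D - {x})\<close> are independent hyperplanes of one projective space, so that
  their intersections form a Boolean lattice indexed by the subsets of \<open>D\<close>. The intersection
  belonging to \<open>A\<close> does not depend on the choice of \<open>D \<supseteq> A\<close>; the empty set yields \<open>N\<close>, and the
  singletons yield the frame.
\<close>

section \<open>Spans and independence\<close>

text \<open>A graph isomorphism does not distinguish the two types of cliques of a Grassmann graph,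
  so the types have to be recovered. A triangle of both types lies on one line of the Grassmann
  space, which independence forbids; hence every triangle in question has exactly one type. What is
  needed is that the triangles \<open>insert x A\<close>, \<open>insert y A\<close>,
  \<open>insert z A\<close> over an \<open>m\<close>-set \<open>A\<close> are of star type: this
  makes the subspace assigned to a set survive the exchange of one element of \<open>D\<close>. If
  \<open>l \<ge> m + 4\<close>, a free coordinate leads from \<open>z\<close> to \<open>- z\<close>,
  and a triangle of the wrong type would make vertices with opposite elements adjacent. If
  \<open>l < 2 * m + 2\<close>, the counting bound decides. There remains
  \<open>2 * m + 2 \<le> l \<le> m + 3\<close> with \<open>m > 0\<close>, that is,
  \<open>m = 1\<close> and \<open>l = 4\<close>; composing with an automorphism then changes the
  labelling of \<open>X\<close>, but not \<open>X\<close>. If \<open>l = m + 2\<close>, there are no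
  triangles of this form, and four-cycles take their place.\<close>

lemma geom_span_superset: "Z \<subseteq> geom_span P L Z"
  by (auto simp: geom_span_def)

lemma geom_span_incl [simp, intro]: "x \<in> Z \<Longrightarrow> x \<in> geom_span P L Z"
  by (auto simp: geom_span_def)

lemma geom_span_least: "geom_subspace P L X \<Longrightarrow> Z \<subseteq> X \<Longrightarrow>
  geom_span P L Z \<subseteq> X"
  by (auto simp: geom_span_def)

lemma geom_span_minimal: "Y \<subseteq> geom_span P L Z \<Longrightarrow>
  geom_span P L Y \<subseteq> geom_span P L Z"
  unfolding geom_span_def by blast

lemma geom_span_mono: "Y \<subseteq> Z \<Longrightarrow>
  geom_span P L Y \<subseteq> geom_span P L Z"
  unfolding geom_span_def by blast

lemma geom_span_subspace_eq: "geom_subspace P L X \<Longrightarrow> geom_span P L X = X"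
  using geom_span_least[of P L X X] geom_span_superset[of X P L] by blast

lemma geom_span_closed:
  assumes "l \<in> L" "p \<in> l" "q \<in> l" "p \<noteq> q" "p \<in> geom_span P L Z"
    "q \<in> geom_span P L Z" "x \<in> l"
  shows "x \<in> geom_span P L Z"
  unfolding geom_span_def
proof (rule InterI)
  fix X assume X: "X \<in> {X. geom_subspace P L X \<and> Z \<subseteq> X}"
  then have "p \<in> X" "q \<in> X" using assms(5,6) by (auto simp: geom_span_def)
  then have "l \<subseteq> X" using X assms(1-4) by (simp add: geom_subspace_def)
  then show "x \<in> X" using assms(7) by blast
qed

lemma geom_span_Un_span: "geom_span P L (Y \<union> geom_span P L Z) = geom_span P L (Y \<union> Z)"
proof
  have "Y \<union> geom_span P L Z \<subseteq> geom_span P L (Y \<union> Z)"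
    using geom_span_superset[of "Y \<union> Z" P L] geom_span_mono[of Z "Y \<union> Z" P L] by blast
  then show "geom_span P L (Y \<union> geom_span P L Z) \<subseteq> geom_span P L (Y \<union> Z)"
    by (rule geom_span_minimal)
  show "geom_span P L (Y \<union> Z) \<subseteq> geom_span P L (Y \<union> geom_span P L Z)"
    using geom_span_superset[of Z P L] by (intro geom_span_mono) blast
qed

text \<open>Deleting a single point is the critical case: every proper subset of \<open>Z\<close>
  lies in some \<open>Z - {z}\<close>, and spans are monotone.\<close>

lemma geom_independent_iff:
  "geom_independent P L Z \<longleftrightarrow> Z \<subseteq> P \<and>
    (\<forall>z\<in>Z. z \<notin> geom_span P L (Z - {z}))"
proof -
  have "(\<exists>Y. Y \<subset> Z \<and> geom_span P L Y = geom_span P L Z) \<longleftrightarrow>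
    (\<exists>z\<in>Z. z \<in> geom_span P L (Z - {z}))"
  proof
    assume "\<exists>Y. Y \<subset> Z \<and> geom_span P L Y = geom_span P L Z"
    then obtain Y where Y: "Y \<subset> Z" "geom_span P L Y = geom_span P L Z" by auto
    from Y(1) obtain z where z: "z \<in> Z" "z \<notin> Y" by blast
    have "z \<in> geom_span P L Z" using z(1) geom_span_superset[of Z P L] by blast
    moreover have "geom_span P L Y \<subseteq> geom_span P L (Z - {z})"
      using Y(1) z by (intro geom_span_mono) blast
    ultimately show "\<exists>z\<in>Z. z \<in> geom_span P L (Z - {z})" using Y(2) z(1) by auto
  next
    assume "\<exists>z\<in>Z. z \<in> geom_span P L (Z - {z})"
    then obtain z where z: "z \<in> Z" "z \<in> geom_span P L (Z - {z})" by blast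
    then have "Z \<subseteq> geom_span P L (Z - {z})" using geom_span_superset[of "Z - {z}" P L]
      by blast
    then have "geom_span P L (Z - {z}) = geom_span P L Z"
      by (intro equalityI geom_span_minimal geom_span_mono) auto
    then show "\<exists>Y. Y \<subset> Z \<and> geom_span P L Y = geom_span P L Z"
      using z(1) by (intro exI[of _ "Z - {z}"]) auto
  qed
  then show ?thesis unfolding geom_independent_def by blast
qed

lemma geom_independent_subset: "geom_independent P L Z \<Longrightarrow>
  Y \<subseteq> Z \<Longrightarrow> geom_independent P L Y"
  unfolding geom_independent_iff by (meson Diff_mono geom_span_mono order_refl subset_iff)

section \<open>Singular subspaces of a polar space\<close>

locale polar_geometry =
  fixes P :: "'a set" and L :: "'a set set" and n :: nat
  assumes rank: "polar_space_of_rank P L n"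
begin

abbreviation col :: "'a \<Rightarrow> 'a \<Rightarrow> bool" where "col \<equiv> pt_collinear P L"
abbreviation span :: "'a set \<Rightarrow> 'a set" where "span \<equiv> geom_span P L"
abbreviation sing :: "'a set \<Rightarrow> bool" where "sing \<equiv> singular_subspace P L"

lemma polar: "polar_space P L"
  using rank by (simp add: polar_space_of_rank_def)

lemma pls: "partial_linear_space P L"
  using polar by (simp add: polar_space_def)

lemma line_subset: "l \<in> L \<Longrightarrow> l \<subseteq> P"
  using pls by (simp add: partial_linear_space_def)

lemma line_unique: "l \<in> L \<Longrightarrow> l' \<in> L \<Longrightarrow>
  p \<noteq> q \<Longrightarrow> p \<in> l \<Longrightarrow> q \<in> l \<Longrightarrow> p \<in> l' \<Longrightarrow> q \<in> l' \<Longrightarrow> l = l'"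
  using pls unfolding partial_linear_space_def by (metis empty_subsetI insert_subset)

lemma one_or_all: "p \<in> P \<Longrightarrow> l \<in> L \<Longrightarrow>
  q \<in> l \<Longrightarrow> r \<in> l \<Longrightarrow> q \<noteq> r \<Longrightarrow> col p q \<Longrightarrow> col p r \<Longrightarrow> x \<in> l \<Longrightarrow> col p x"
  using polar unfolding polar_space_def by metis

lemma col_sym: "col p q \<Longrightarrow> col q p"
  by (auto simp: pt_collinear_def)

lemma col_refl: "p \<in> P \<Longrightarrow> col p p"
  by (simp add: pt_collinear_def)

lemma col_in: "col p q \<Longrightarrow> p \<in> P" "col p q \<Longrightarrow> q \<in> P"
  by (auto simp: pt_collinear_def)

lemma col_line: "col p q \<Longrightarrow> p \<noteq> q \<Longrightarrow>
  \<exists>l\<in>L. p \<in> l \<and> q \<in> l"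
  by (auto simp: pt_collinear_def)

lemma subspace_P: "geom_subspace P L P"
  using line_subset by (auto simp: geom_subspace_def)

lemma subspace_Int: "geom_subspace P L S \<Longrightarrow> geom_subspace P L T \<Longrightarrow>
  geom_subspace P L (S \<inter> T)"
  unfolding geom_subspace_def by (metis Int_iff Int_subset_iff le_infI1)

lemma subspace_span: "Z \<subseteq> P \<Longrightarrow> geom_subspace P L (span Z)"
  unfolding geom_subspace_def[of P L "span Z"]
proof (intro conjI ballI impI subsetI)
  show "x \<in> P" if "Z \<subseteq> P" "x \<in> span Z" for x
    using that geom_span_least[OF subspace_P] by (metis subsetD)
qed (rule geom_span_closed)

lemma sing_sub: "sing S \<Longrightarrow> geom_subspace P L S"
  by (simp add: singular_subspace_def)

lemma sing_P: "sing S \<Longrightarrow> S \<subseteq> P"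
  by (simp add: singular_subspace_def geom_subspace_def)

lemma sing_col: "sing S \<Longrightarrow> p \<in> S \<Longrightarrow> q \<in> S \<Longrightarrow>
  col p q"
  by (simp add: singular_subspace_def)

lemma sing_line: "sing S \<Longrightarrow> l \<in> L \<Longrightarrow> p \<in> S \<Longrightarrow>
  q \<in> S \<Longrightarrow> p \<noteq> q \<Longrightarrow> p \<in> l \<Longrightarrow> q \<in> l \<Longrightarrow> l \<subseteq> S"
  by (simp add: singular_subspace_def geom_subspace_def)

lemma sing_span_eq: "sing S \<Longrightarrow> span S = S"
  using geom_span_subspace_eq sing_sub by blast

lemma sing_least: "sing S \<Longrightarrow> Z \<subseteq> S \<Longrightarrow> span Z \<subseteq> S"
  using geom_span_least sing_sub by blast

lemma sing_subspace: "sing S \<Longrightarrow> geom_subspace P L T \<Longrightarrow>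
  T \<subseteq> S \<Longrightarrow> sing T"
  by (auto simp: singular_subspace_def)

lemma sing_Int: "sing S \<Longrightarrow> sing T \<Longrightarrow> sing (S \<inter> T)"
  using subspace_Int sing_subspace sing_sub by (metis inf_le1)

lemma sing_empty: "sing {}"
  by (simp add: singular_subspace_def geom_subspace_def)

section \<open>Perps and spans of collinear sets\<close>

definition perp :: "'a set \<Rightarrow> 'a set" where
  "perp Z = {p \<in> P. \<forall>z\<in>Z. col p z}"

lemma subspace_perp: "geom_subspace P L (perp Z)"
  unfolding geom_subspace_def
proof (intro conjI ballI impI)
  show "perp Z \<subseteq> P" by (auto simp: perp_def)
  fix l p q assume a: "l \<in> L" "p \<in> perp Z" "q \<in> perp Z" "p \<noteq> q" "p \<in> l"
    "q \<in> l"
  show "l \<subseteq> perp Z"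
  proof
    fix x assume x: "x \<in> l"
    have "col x z" if "z \<in> Z" for z
      using one_or_all[of z l p q x] a x that col_in col_sym by (auto simp: perp_def)
    then show "x \<in> perp Z" using line_subset a x by (auto simp: perp_def)
  qed
qed

lemma span_perp: "Z \<subseteq> perp Y \<Longrightarrow> span Z \<subseteq> perp Y"
  by (rule geom_span_least[OF subspace_perp])

text \<open>A perp is a subspace by the one-or-all axiom. Collinearity therefore passes from
  generators to spans, in one argument at a time.\<close>

lemma col_span2:
  assumes "\<And>y z. y \<in> Y \<Longrightarrow> z \<in> Z \<Longrightarrow> col y z"
    "Y \<subseteq> P" "Z \<subseteq> P" "y \<in> span Y" "z \<in> span Z"
  shows "col y z"
proof -
  have "Y \<subseteq> perp Z" using assms by (auto simp: perp_def)
  then have "span Y \<subseteq> perp Z" by (rule span_perp)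
  then have "Z \<subseteq> perp (span Y)" using assms(3) col_sym by (auto simp: perp_def)
  then have "span Z \<subseteq> perp (span Y)" by (rule span_perp)
  then show ?thesis using assms col_sym by (auto simp: perp_def)
qed

definition collinear_set :: "'a set \<Rightarrow> bool" where
  "collinear_set Z \<longleftrightarrow> (\<forall>p\<in>Z. \<forall>q\<in>Z. col p q)"

lemma collinear_set_P: "collinear_set Z \<Longrightarrow> Z \<subseteq> P"
  using col_in by (auto simp: collinear_set_def)

lemma collinear_set_mono: "collinear_set Z \<Longrightarrow> Y \<subseteq> Z \<Longrightarrow>
  collinear_set Y"
  by (auto simp: collinear_set_def)

lemma sing_collinear_set: "sing S \<Longrightarrow> collinear_set S"
  by (auto simp: collinear_set_def singular_subspace_def)

lemma sing_span:
  assumes "collinear_set Z"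
  shows "sing (span Z)"
proof -
  have "Z \<subseteq> P" using assms by (rule collinear_set_P)
  moreover have "col y z" if "y \<in> Z" "z \<in> Z" for y z using assms that
    by (simp add: collinear_set_def)
  ultimately show ?thesis
    unfolding singular_subspace_def using subspace_span col_span2[of Z Z] by simp
qed

section \<open>Projective geometry inside singular subspaces\<close>

lemma maximal_extension:
  assumes "sing S"
  shows "\<exists>M. maximal_singular_subspace P L M \<and> S \<subseteq> M"
proof -
  let ?A = "{T. sing T \<and> S \<subseteq> T}"
  have "\<exists>M\<in>?A. \<forall>X\<in>?A. M \<subseteq> X \<longrightarrow> X = M"
  proof (rule subset_Zorn_nonempty)
    show "?A \<noteq> {}" using assms by blast
    fix C assume C: "C \<noteq> {}" "subset.chain ?A C"
    have "\<forall>S\<in>C. sing S"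
      "\<forall>S\<in>C. \<forall>T\<in>C. S \<subseteq> T \<or> T \<subseteq> S"
      using C(2) subset_chain_def[of ?A C] by auto
    \<comment> \<open>Chains of singular subspaces are finite by the last polar axiom, so the union
      of a nonempty chain is one of its members.\<close>
    then have "finite C"
      using polar unfolding polar_space_def by simp
    then have "\<Union>C \<in> C" using C
      by (rule Union_in_chain)
    then show "\<Union>C \<in> ?A" using C by (auto simp: subset.chain_def)
  qed
  then show ?thesis unfolding maximal_singular_subspace_def by fastforce
qed

text \<open>The rank condition provides the Veblen--Young axiom in maximal singular subspaces; any
  other singular subspace is placed inside a maximal one.\<close>

lemma veblen:
  assumes "sing S" "{a,b,c,d} \<subseteq> S" "distinct [a,b,c,d]" "ab \<in> L" "cd \<in> L"
    "ac \<in> L" "bd \<in> L"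
    "{a,b} \<subseteq> ab" "{c,d} \<subseteq> cd" "{a,c} \<subseteq> ac" "{b,d} \<subseteq> bd"
      "ab \<inter> cd \<noteq> {}"
  shows "ac \<inter> bd \<noteq> {}"
proof -
  obtain M where M: "maximal_singular_subspace P L M" "S \<subseteq> M"
    using maximal_extension[OF assms(1)] by auto
  then have sM: "sing M" by (simp add: maximal_singular_subspace_def)
  have pr: "projective_space M {l\<in>L. l \<subseteq> M}"
    using rank M by (simp add: polar_space_of_rank_def)
  have "ab \<subseteq> M" "cd \<subseteq> M" "ac \<subseteq> M" "bd \<subseteq> M"
    using sing_line[OF sM] assms M(2) by (simp_all, blast+)
  then have "ab \<in> {l\<in>L. l \<subseteq> M}" "cd \<in> {l\<in>L. l \<subseteq> M}"
    "ac \<in> {l\<in>L. l \<subseteq> M}" "bd \<in> {l\<in>L. l \<subseteq> M}"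
    using assms by auto
  with pr assms show ?thesis unfolding projective_space_def by meson
qed

text \<open>If \<open>p\<close> is collinear with all points of a singular subspace \<open>S\<close>
  and lies outside it, drawing the lines from \<open>p\<close> to \<open>S\<close> once already
  produces the whole span. This explicit form replaces the closure process in the exchange property
  and in the hyperplane argument.\<close>

definition cone :: "'a \<Rightarrow> 'a set \<Rightarrow> 'a set" where
  "cone p S = insert p {x. \<exists>l\<in>L. \<exists>s\<in>S. p \<in> l \<and> s \<in> l \<and>
    x \<in> l}"

text \<open>Let \<open>u\<close> and \<open>v\<close> lie on lines through \<open>p\<close> that
  meet \<open>S\<close> in \<open>s\<close> and \<open>t\<close>, and let \<open>w\<close> be on the
  line \<open>uv\<close>. Veblen--Young is used twice: \<open>pw\<close> meets \<open>sv\<close> in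
  a point \<open>x\<close>, because \<open>ps\<close> and \<open>wv\<close> meet in
  \<open>u\<close>; then \<open>px\<close> meets \<open>ts\<close>, because \<open>pt\<close> and
  \<open>xs\<close> meet in \<open>v\<close>. So the line \<open>pw\<close> meets
  \<open>S\<close>.\<close>

lemma subspace_cone:
  assumes S: "sing S" and p: "p \<in> perp S" "p \<notin> S"
  shows "geom_subspace P L (cone p S)"
  unfolding geom_subspace_def
proof (intro conjI ballI impI)
  have pP: "p \<in> P" using p by (simp add: perp_def)
  then show "cone p S \<subseteq> P" using line_subset by (auto simp: cone_def)
  have "collinear_set (insert p S)"
    using sing_collinear_set[OF S] p pP col_refl[OF pP]
      by (auto simp: collinear_set_def perp_def intro: col_sym)
  then have sM: "sing (span (insert p S))" by (rule sing_span)
  let ?M = "span (insert p S)"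
  have pM: "p \<in> ?M" "S \<subseteq> ?M" using geom_span_superset by auto
  fix g u v assume a: "g \<in> L" "u \<in> cone p S" "v \<in> cone p S" "u \<noteq> v" "u \<in> g"
    "v \<in> g"
  show "g \<subseteq> cone p S"
  proof
    fix w assume w: "w \<in> g"
    show "w \<in> cone p S"
    proof (cases "p \<in> g")
      case True
      then obtain x where x: "x \<in> cone p S" "x \<noteq> p" "x \<in> g" using a by blast
      then obtain l s where l: "l \<in> L" "s \<in> S" "p \<in> l" "s \<in> l" "x \<in> l"
        by (auto simp: cone_def)
      then have "l = g" using line_unique[of l g p x] a True x by blast
      then show ?thesis using l w by (auto simp: cone_def)
    next
      case False
      then obtain hu s where hu: "hu \<in> L" "s \<in> S" "p \<in> hu" "s \<in> hu" "u \<in> hu"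
        using a by (auto simp: cone_def)
      obtain hv t where hv: "hv \<in> L" "t \<in> S" "p \<in> hv" "t \<in> hv" "v \<in> hv"
        using a False by (auto simp: cone_def)
      have ne: "p \<noteq> u" "p \<noteq> v" "p \<noteq> w" "p \<noteq> s" "p \<noteq> t"
        using False a w p hu hv by auto
      have hne: "hu \<noteq> hv" using line_unique[of hu g u v] hu hv a False by blast
      have st: "s \<noteq> t" using line_unique[of hu hv p s] hu hv hne ne by blast
      have uM: "u \<in> ?M" "v \<in> ?M"
        using sing_line[OF sM, of hu p s] sing_line[OF sM, of hv p t] hu hv ne pM by blast+
      then have wM: "w \<in> ?M" using sing_line[OF sM, of g u v] a w by blast
      obtain e where e: "e \<in> L" "s \<in> e" "t \<in> e"
        using col_line[of s t] sing_col[OF S] st hu hv by blast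
      have eS: "e \<subseteq> S" using sing_line[OF S] e hu hv st by blast
      obtain q where q: "q \<in> L" "p \<in> q" "w \<in> q"
        using col_line[of p w] sing_col[OF sM] pM wM ne by blast
      have key: ?thesis if "q \<inter> S \<noteq> {}"
        using that q by (auto simp: cone_def)
      show ?thesis
      proof (cases "w = u \<or> w = v \<or> w = s \<or> s \<in> q")
        case True
        then show ?thesis using a key hu q by auto
      next
        case f: False
        have sv: "s \<noteq> v" using line_unique[of hu hv p s] hu hv hne ne by blast
        obtain y where y: "y \<in> L" "s \<in> y" "v \<in> y"
          using col_line[of s v] sing_col[OF sM] pM uM sv hu by blast
        have "q \<inter> y \<noteq> {}"
        proof (rule veblen[OF sM, where a=p and b=s and c=w and d=v and ab=hu and cd=g])
          show "distinct [p,s,w,v]" using ne f sv by auto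
        qed (use pM wM uM hu y q a w in auto)
        then obtain x where x: "x \<in> q" "x \<in> y" by blast
        have xp: "x \<noteq> p" using line_unique[of y hu p s] y hu ne hne line_unique[of hu hv p v]
          hv x by blast
        have xs: "x \<noteq> s" using f x by blast
        show ?thesis
        proof (cases "x = t")
          case True then show ?thesis using key x hv by blast
        next
          case xt: False
          have xM: "x \<in> ?M" using sing_line[OF sM, of y s v] y sv pM uM hu x by blast
          have "q \<inter> e \<noteq> {}"
          proof (rule veblen[OF sM, where a=p and b=t and c=x and d=s and ab=hv and cd=y])
            show "distinct [p,t,x,s]" using ne xt xs xp st by auto
          qed (use pM xM hu hv y q x e in auto)
          then show ?thesis using key eS by blast
        qed
      qed
    qed
  qed
qed

lemma collinear_set_insert:
  assumes "p \<in> P"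
  shows "collinear_set (insert p Z) \<longleftrightarrow> collinear_set Z \<and> p \<in> perp Z"
  using assms col_refl[OF assms] by (auto simp: collinear_set_def perp_def intro: col_sym)

lemma collinear_set_insertI: "collinear_set Z \<Longrightarrow> p \<in> perp Z \<Longrightarrow>
  collinear_set (insert p Z)"
  using collinear_set_insert[of p Z] by (simp add: perp_def)

lemma collinear_set_insertD: "collinear_set (insert p Z) \<Longrightarrow> collinear_set Z \<and>
  p \<in> perp Z"
  using collinear_set_insert[of p Z] collinear_set_P[of "insert p Z"] by simp

lemma span_insert:
  assumes S: "sing S" and p: "p \<in> perp S" "p \<notin> S"
  shows "span (insert p S) = cone p S"
proof
  have "insert p S \<subseteq> cone p S"
  proof
    fix x assume "x \<in> insert p S"
    then show "x \<in> cone p S"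
      using p col_line[of p x] by (auto simp: cone_def perp_def)
  qed
  then show "span (insert p S) \<subseteq> cone p S"
    by (rule geom_span_least[OF subspace_cone[OF assms]])
  show "cone p S \<subseteq> span (insert p S)"
  proof
    fix x assume "x \<in> cone p S"
    then consider "x = p" | l s where "l \<in> L" "s \<in> S" "p \<in> l" "s \<in> l" "x \<in> l"
      by (auto simp: cone_def)
    then show "x \<in> span (insert p S)"
    proof cases
      case 1 then show ?thesis using geom_span_superset by fast
    next
      case 2
      show ?thesis
        by (rule geom_span_closed[of l L p s]) (use 2 p geom_span_superset[of "insert p S"] in auto)
    qed
  qed
qed

lemma span_perp_of: "collinear_set Z \<Longrightarrow> p \<in> perp Z \<Longrightarrow>
  p \<in> perp (span Z)"
  using col_span2[of "{p}" Z p] collinear_set_P[of Z] geom_span_superset[of "{p}" P L]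
    unfolding perp_def by auto

text \<open>By the cone description, \<open>q\<close> is \<open>p\<close> or lies on a line joining
  \<open>p\<close> to some \<open>s\<close> in \<open>span Z\<close>. As \<open>q\<close> differs
  from \<open>s\<close>, this is also the line joining \<open>q\<close> to \<open>s\<close>, and it
  carries \<open>p\<close>.\<close>

lemma exchange:
  assumes c: "collinear_set (insert p Z)" and q: "q \<in> span (insert p Z)" "q \<notin> span Z"
  shows "p \<in> span (insert q Z)"
proof -
  have Z: "collinear_set Z" "p \<in> perp Z" using collinear_set_insertD[OF c] by auto
  have S: "sing (span Z)" and p: "p \<in> perp (span Z)"
    using Z sing_span span_perp_of by auto
  have pS: "p \<notin> span Z"
    using q geom_span_minimal[of "insert p Z" P L Z] geom_span_superset[of Z P L] by blast
  have "q \<in> span (insert p (span Z))"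
    using q geom_span_mono[of "insert p Z" "insert p (span Z)" P L] geom_span_superset[of Z P L]
      by blast
  then have "q \<in> cone p (span Z)" using span_insert[OF S p pS] by simp
  moreover have "p \<in> span (insert p Z)" "q \<in> span (insert q Z)" using geom_span_superset
    by fast+
  moreover have "p \<in> span (insert q Z)"
    if "l \<in> L" "s \<in> span Z" "p \<in> l" "s \<in> l" "q \<in> l" for l s
    by (rule geom_span_closed[of l L q s])
      (use that q geom_span_superset[of "insert q Z"] geom_span_mono[of Z "insert q Z" P L] in auto)
  ultimately show ?thesis by (auto simp: cone_def)
qed

section \<open>Independent sets, bases and dimension\<close>

abbreviation indep :: "'a set \<Rightarrow> bool" where "indep \<equiv> geom_independent P L"

lemma indep_insert:
  assumes I: "indep I" and c: "collinear_set (insert g I)" and g: "g \<notin> span I"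
  shows "indep (insert g I)"
  unfolding geom_independent_iff
proof (intro conjI ballI)
  show "insert g I \<subseteq> P" using collinear_set_P[OF c] .
  fix z assume z: "z \<in> insert g I"
  show "z \<notin> span (insert g I - {z})"
  proof (cases "z = g")
    case True
    then show ?thesis using g geom_span_mono[of "insert g I - {z}" I P L] by blast
  next
    case False
    then have zI: "z \<in> I" and e: "insert g I - {z} = insert g (I - {z})" using z by auto
    show ?thesis
    proof
      assume "z \<in> span (insert g I - {z})"
      moreover have "z \<notin> span (I - {z})" using I zI by (auto simp: geom_independent_iff)
      moreover have "collinear_set (insert g (I - {z}))" by (rule collinear_set_mono[OF c]) auto
      ultimately have "g \<in> span (insert z (I - {z}))" using exchange e by metis
      then show False using g zI by (simp add: insert_absorb)
    qed
  qed
qed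

text \<open>Each \<open>x\<close> in \<open>I\<close> outside \<open>G\<close> is traded for a
  generator \<open>g\<close> not in the span of \<open>I - {x}\<close>; such a \<open>g\<close>
  exists, since otherwise \<open>x\<close> would lie in that span. The induction counts the elements
  of \<open>I\<close> not yet in \<open>G\<close>.\<close>

lemma steinitz:
  assumes "finite G" "collinear_set G"
  shows "finite I \<Longrightarrow> indep I \<Longrightarrow> I \<subseteq> span G \<Longrightarrow>
    card I \<le> card G"
proof (induction "card (I - G)" arbitrary: I rule: less_induct)
  case less
  show ?case
  proof (cases "I \<subseteq> G")
    case True then show ?thesis using assms card_mono by blast
  next
    case False
    then obtain x where x: "x \<in> I" "x \<notin> G" by blast
    have "\<not> G \<subseteq> span (I - {x})"
      using geom_span_minimal[of G P L "I - {x}"] less.prems x by (auto simp: geom_independent_iff)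
    then obtain g where g: "g \<in> G" "g \<notin> span (I - {x})" by blast
    then have gI: "g \<notin> I - {x}" using geom_span_superset by fast
    have GS: "G \<subseteq> span G" by (rule geom_span_superset)
    have c: "collinear_set (insert g (I - {x}))"
      by (rule collinear_set_mono[OF sing_collinear_set[OF sing_span[OF assms(2)]]]) (use less.prems g GS in auto)
    have i: "indep (insert g (I - {x}))"
      by (rule indep_insert[OF geom_independent_subset[OF less.prems(2)] c g(2)]) auto
    have "insert g (I - {x}) - G = (I - G) - {x}" using g by auto
    then have "card (insert g (I - {x}) - G) < card (I - G)"
      using x less.prems by (metis Diff_iff card_Diff1_less finite_Diff)
    then have "card (insert g (I - {x})) \<le> card G"
      by (rule less.hyps) (use less.prems g i GS in auto)
    moreover have "card (insert g (I - {x})) = card I"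
      using gI x less.prems by (metis card_Suc_Diff1 card_insert_disjoint finite_Diff)
    ultimately show ?thesis by simp
  qed
qed

lemma dim_unique:
  assumes "sing S" "has_geom_dim P L S d" "has_geom_dim P L S e"
  shows "d = e"
proof -
  obtain B C where B: "finite B" "indep B" "span B = S" "int (card B) = d + 1"
    and C: "finite C" "indep C" "span C = S" "int (card C) = e + 1"
    using assms unfolding has_geom_dim_def by blast
  have "B \<subseteq> S" "C \<subseteq> S" using B C geom_span_superset by blast+
  then have "collinear_set B" "collinear_set C"
    using sing_collinear_set[OF assms(1)] collinear_set_mono by blast+
  then have "card B = card C" using steinitz B C \<open>B \<subseteq> S\<close> \<open>C \<subseteq>
    S\<close> by (metis le_antisym)
  then show ?thesis using B C by simp
qed

text \<open>A maximal singular subspace has a basis of \<open>n\<close> elements, which bounds every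
  finite subset of \<open>I\<close>; the uniform bound forces \<open>I\<close> itself to be
  finite.\<close>

lemma card_indep_le:
  assumes "sing S" "indep I" "I \<subseteq> S" 
  shows "finite I \<and> card I \<le> n"
proof -
  obtain M where M: "maximal_singular_subspace P L M" "S \<subseteq> M"
    using maximal_extension assms by blast
  then have sM: "sing M" by (simp add: maximal_singular_subspace_def)
  obtain B where B: "finite B" "span B = M" "int (card B) = int n"
    using rank M unfolding polar_space_of_rank_def has_geom_dim_def by force
  have "collinear_set B" using collinear_set_mono[OF sing_collinear_set[OF sM]] B geom_span_superset
    by metis
  then have *: "card J \<le> n" if "finite J" "J \<subseteq> I" for J
    using steinitz[OF B(1), of J] geom_independent_subset[OF assms(2)] that assms M B by auto
  have "finite I"
    by (metis * finite_if_finite_subsets_card_bdd)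
  then show ?thesis using * by blast
qed

lemma indep_empty: "indep {}" by (simp add: geom_independent_iff)

lemma extend_to_basis:
  assumes S: "sing S" and I: "indep I" "I \<subseteq> S"
  shows "\<exists>B. I \<subseteq> B \<and> finite B \<and> indep B \<and> span B = S"
proof -
  let ?F = "\<lambda>B. I \<subseteq> B \<and> indep B \<and> B \<subseteq> S"
  have "\<exists>B. ?F B \<and> (\<forall>C. ?F C \<longrightarrow> card C \<le> card B)"
    using I card_indep_le[OF S]
    by (intro ex_has_greatest_nat[of ?F I card "Suc n"]) (auto simp: less_Suc_eq_le)
  then obtain B where B: "I \<subseteq> B" "indep B" "B \<subseteq> S"
    and max: "\<And>C. ?F C \<Longrightarrow> card C \<le> card B" by blast
  have fB: "finite B" using card_indep_le[OF S] B by blast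
  have "S \<subseteq> span B"
  proof (rule ccontr)
    assume "\<not> S \<subseteq> span B"
    then obtain x where x: "x \<in> S" "x \<notin> span B" by blast
    then have "x \<notin> B" using geom_span_superset by fast
    have "indep (insert x B)"
      by (rule indep_insert[OF B(2) collinear_set_mono[OF sing_collinear_set[OF S]] x(2)]) (use x B in auto)
    then have "card (insert x B) \<le> card B" using max[of "insert x B"] B x by auto
    then show False using \<open>x \<notin> B\<close> fB by simp
  qed
  then show ?thesis using B fB sing_least[OF S B(3)] by blast
qed

text \<open>Functional form of the dimension relation. It is meaningful on singular subspaces, where
  a dimension exists and is unique.\<close>

definition sdim :: "'a set \<Rightarrow> int" where
  "sdim S = (THE d. has_geom_dim P L S d)"

lemma has_dim_iff:
  assumes "sing S"
  shows "has_geom_dim P L S d \<longleftrightarrow> sdim S = d"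
proof -
  obtain B where "finite B" "indep B" "span B = S"
    using extend_to_basis[OF assms indep_empty] by auto
  then have "has_geom_dim P L S (int (card B) - 1)" unfolding has_geom_dim_def by force
  then have "\<exists>!d. has_geom_dim P L S d" using dim_unique[OF assms] by blast
  then show ?thesis unfolding sdim_def by (metis theI')
qed

lemma grass_iff: "S \<in> polar_grass P L j \<longleftrightarrow> sing S \<and> sdim S = j"
  using has_dim_iff by (auto simp: polar_grass_def)

lemma basis_dim: "sing S \<Longrightarrow> finite B \<Longrightarrow> indep B \<Longrightarrow>
  span B = S \<Longrightarrow> sdim S = int (card B) - 1"
  using has_dim_iff[of S "int (card B) - 1"] unfolding has_geom_dim_def by force

lemma dim_ge: "sing S \<Longrightarrow> -1 \<le> sdim S"
  using extend_to_basis[OF _ indep_empty] basis_dim by fastforce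

lemma dim_le: "sing S \<Longrightarrow> sdim S \<le> int n - 1"
  using extend_to_basis[OF _ indep_empty, of S] basis_dim[of S] card_indep_le[of S]
    geom_span_superset by fastforce

lemma sing_insert: "sing S \<Longrightarrow> p \<in> perp S \<Longrightarrow>
  sing (span (insert p S))"
  by (intro sing_span collinear_set_insertI sing_collinear_set)

lemma dim_insert:
  assumes S: "sing S" and p: "p \<in> perp S" "p \<notin> S"
  shows "sdim (span (insert p S)) = sdim S + 1"
proof -
  obtain B where B: "finite B" "indep B" "span B = S"
    using extend_to_basis[OF S indep_empty] by auto
  have BS: "B \<subseteq> S" using B geom_span_superset by blast
  have "collinear_set (insert p B)"
    by (rule collinear_set_mono[OF collinear_set_insertI[OF sing_collinear_set[OF S] p(1)]]) (use BS in auto)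
  then have "indep (insert p B)" using indep_insert B p by auto
  moreover have "span (insert p B) = span (insert p S)"
    using geom_span_Un_span[of P L "{p}" B] B by simp
  moreover have "p \<notin> B" using BS p by blast
  ultimately show ?thesis
    using basis_dim[OF sing_insert[OF S p(1)], of "insert p B"] basis_dim[OF S B] B by simp
qed

lemma sing_perp: "sing T \<Longrightarrow> p \<in> T \<Longrightarrow>
  S \<subseteq> T \<Longrightarrow> p \<in> perp S"
  using sing_P sing_col by (auto simp: perp_def)

lemma dim_psubset:
  assumes "sing S" "sing T" "S \<subset> T"
  shows "sdim S < sdim T"
proof -
  obtain B where B: "finite B" "indep B" "span B = S"
    using extend_to_basis[OF assms(1) indep_empty] by auto
  then have BT: "B \<subseteq> T" using geom_span_superset assms by blast
  obtain C where C: "B \<subseteq> C" "finite C" "indep C" "span C = T"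
    using extend_to_basis[OF assms(2) B(2) BT] by blast
  then have "B \<noteq> C" using B assms by blast
  then have "card B < card C" using C by (simp add: psubset_card_mono psubsetI)
  then show ?thesis using basis_dim[OF assms(1) B] basis_dim[OF assms(2) C(2-4)] by simp
qed

lemma dim_mono: "sing S \<Longrightarrow> sing T \<Longrightarrow> S \<subseteq> T \<Longrightarrow>
  sdim S \<le> sdim T"
  using dim_psubset by (metis less_le order_refl psubsetI)

lemma dim_eq: "sing S \<Longrightarrow> sing T \<Longrightarrow> S \<subseteq> T \<Longrightarrow>
  sdim T \<le> sdim S \<Longrightarrow> S = T"
  using dim_psubset by (metis linorder_not_less psubsetI)

lemma hyperplane_span:
  assumes "sing V" "sing W" "V \<subseteq> W" "sdim W = sdim V + 1" "t \<in> W" "t \<notin> V"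
  shows "span (insert t V) = W"
proof -
  have t: "t \<in> perp V" using sing_perp assms by blast
  show ?thesis
    by (rule dim_eq[OF sing_insert[OF assms(1) t]])
      (use assms dim_insert[OF assms(1) t] sing_least[OF assms(2)] in auto)
qed

text \<open>
  The step that uses projective, not merely matroidal, geometry; the modular law follows from it.
\<close>

lemma hyperplane_Int:
  assumes V: "sing V" and W: "sing W" and VW: "V \<subseteq> W" "sdim W = sdim V + 1"
    and T: "sing T" "T \<subseteq> W" "\<not> T \<subseteq> V"
  shows "sdim (T \<inter> V) = sdim T - 1"
proof -
  obtain t where t: "t \<in> T" "t \<notin> V" using T by blast
  have sI: "sing (T \<inter> V)" using sing_Int T V by blast
  have tp: "t \<in> perp (T \<inter> V)" using sing_perp T t by blast
  have tv: "t \<in> perp V" using sing_perp[OF W] T t VW by blast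
  have "T \<subseteq> span (insert t (T \<inter> V))"
  proof
    fix x assume x: "x \<in> T"
    have "x \<in> cone t V"
      using span_insert[OF V tv t(2)] hyperplane_span[OF V W VW _ t(2)] T t x by blast
    then consider "x = t" | l v where "l \<in> L" "v \<in> V" "t \<in> l" "v \<in> l" "x \<in> l"
      "x \<noteq> t" by (auto simp: cone_def)
    then show "x \<in> span (insert t (T \<inter> V))"
    proof cases
      case 1 then show ?thesis using geom_span_superset by fast
    next
      case 2
      then have vT: "v \<in> T" using sing_line[OF T(1), of l t x] t x by blast
      show ?thesis
        by (rule geom_span_closed[of l L t v]) (use 2 t vT in auto)
    qed
  qed
  moreover have "span (insert t (T \<inter> V)) \<subseteq> T" using sing_least T t by auto
  ultimately show ?thesis using dim_insert[OF sI tp] t by force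
qed

section \<open>Joins and the modular law\<close>

definition join :: "'a set \<Rightarrow> 'a set \<Rightarrow> 'a set" where
  "join S T = span (S \<union> T)"

lemma join_sub: "S \<subseteq> join S T" "T \<subseteq> join S T"
  using geom_span_superset[of "S \<union> T"] by (auto simp: join_def)

lemma join_least: "sing W \<Longrightarrow> S \<subseteq> W \<Longrightarrow>
  T \<subseteq> W \<Longrightarrow> join S T \<subseteq> W"
  unfolding join_def by (intro sing_least) auto

lemma join_comm: "join S T = join T S"
  by (simp add: join_def Un_commute)

lemma sing_join: "collinear_set (S \<union> T) \<Longrightarrow> sing (join S T)"
  unfolding join_def by (rule sing_span)

lemma sing_join_in: "sing W \<Longrightarrow> S \<subseteq> W \<Longrightarrow>
  T \<subseteq> W \<Longrightarrow> sing (join S T)"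
  by (intro sing_join collinear_set_mono[OF sing_collinear_set]) auto

text \<open>A basis of \<open>S\<close> is extended to a basis of \<open>W\<close>, and one of the
  added elements is dropped.\<close>

lemma hyperplane_exists:
  assumes "sing S" "sing W" "S \<subset> W"
  shows "\<exists>V. sing V \<and> S \<subseteq> V \<and> V \<subseteq> W \<and>
    sdim W = sdim V + 1"
proof -
  obtain B where B: "finite B" "indep B" "span B = S"
    using extend_to_basis[OF assms(1) indep_empty] by auto
  then have BT: "B \<subseteq> W" using geom_span_superset assms by blast
  obtain C where C: "B \<subseteq> C" "finite C" "indep C" "span C = W"
    using extend_to_basis[OF assms(2) B(2) BT] by blast
  then have "B \<noteq> C" using B assms by auto
  then obtain c where c: "c \<in> C" "c \<notin> B" using C by auto
  have CW: "C \<subseteq> W" using C geom_span_superset by blast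
  have "collinear_set (C - {c})"
    by (rule collinear_set_mono[OF sing_collinear_set[OF assms(2)]]) (use CW in auto)
  then have s: "sing (span (C - {c}))" by (rule sing_span)
  have "sdim (span (C - {c})) = int (card (C - {c})) - 1"
    by (rule basis_dim[OF s]) (use C geom_independent_subset[OF C(3), of "C - {c}"] in auto)
  moreover have "sdim W = int (card C) - 1" using basis_dim assms C by blast
  moreover have "card C = card (C - {c}) + 1" using c C by (metis Suc_eq_plus1 card_Suc_Diff1)
  moreover have "S \<subseteq> span (C - {c})" using B C c geom_span_mono[of B "C - {c}" P L]
    by blast
  moreover have "span (C - {c}) \<subseteq> W" using C geom_span_mono[of "C - {c}" C P L] by blast
  ultimately show ?thesis using s by (intro exI[of _ "span (C - {c})"]) auto
qed

text \<open>Induction on the dimension of \<open>T\<close>. A hyperplane \<open>V\<close> of the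
  join that contains \<open>S\<close> meets \<open>T\<close> in a hyperplane of \<open>T\<close>. A
  point \<open>t\<close> of \<open>T\<close> outside \<open>V\<close> restores \<open>T\<close> from
  \<open>T \<inter> V\<close>, hence also \<open>join S T\<close> from
  \<open>join S (T \<inter> V)\<close>, so both sides of the equation drop by one.\<close>

lemma modular:
  assumes S: "sing S"
  shows "sing T \<Longrightarrow> sing (join S T) \<Longrightarrow>
    sdim (join S T) + sdim (S \<inter> T) = sdim S + sdim T"
proof (induction "nat (sdim T + 1)" arbitrary: T rule: less_induct)
  case less
  note T = less.prems(1) and W = less.prems(2)
  show ?case
  proof (cases "S = join S T")
    case True
    then have "T \<subseteq> S" using join_sub by metis
    then show ?thesis using True by (simp add: Int_absorb1)
  next
    case False
    then have "S \<subset> join S T" using join_sub by blast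
    then obtain V where V: "sing V" "S \<subseteq> V" "V \<subseteq> join S T"
      "sdim (join S T) = sdim V + 1"
      using hyperplane_exists[OF S W] by blast
    have TV: "\<not> T \<subseteq> V" 
    proof
      assume "T \<subseteq> V"
      then have "join S T \<subseteq> V" using join_least V by blast
      then show False using dim_mono[OF W V(1)] V by simp
    qed
    then obtain t where t: "t \<in> T" "t \<notin> V" by blast
    have TVd: "sdim (T \<inter> V) = sdim T - 1"
      by (rule hyperplane_Int[OF V(1) W V(3,4) T join_sub(2) TV])
    have sTV: "sing (T \<inter> V)" using sing_Int T V by blast
    have sJ: "sing (join S (T \<inter> V))" by (rule sing_join_in[OF V(1,2)]) auto
    have JV: "join S (T \<inter> V) \<subseteq> V" by (rule join_least[OF V(1,2)]) auto
    have "join S T \<subseteq> span (insert t (join S (T \<inter> V)))"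
    proof -
      have sub: "insert t (join S (T \<inter> V)) \<subseteq> span (insert t (join S (T \<inter> V)))" by (rule geom_span_superset)
      have tt: "t \<in> perp (join S (T \<inter> V))"
        using sing_perp[OF W] t join_sub(2)[of T S] JV V(3) by blast
      have "T = span (insert t (T \<inter> V))"
        using hyperplane_span[OF sTV T] TVd t by auto
      also have "\<dots> \<subseteq> span (insert t (join S (T \<inter> V)))"
        using join_sub(2)[of "T \<inter> V" S] by (intro geom_span_mono) auto
      finally show ?thesis using join_sub(1)[of S "T \<inter> V"] sub
        by (intro join_least sing_insert[OF sJ tt]) auto
    qed
    moreover have tt: "t \<in> perp (join S (T \<inter> V))"
        using sing_perp[OF W] t join_sub(2)[of T S] JV V(3) by blast
    moreover have "t \<notin> join S (T \<inter> V)" using JV t by blast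
    ultimately have "sdim (join S T) \<le> sdim (join S (T \<inter> V)) + 1"
      using dim_insert[OF sJ tt] dim_mono[OF W sing_insert[OF sJ tt]] by simp
    moreover have "sdim (join S (T \<inter> V)) \<le> sdim V" using dim_mono[OF sJ V(1) JV] .
    ultimately have "sdim (join S (T \<inter> V)) = sdim (join S T) - 1" using V by linarith
    moreover have "S \<inter> (T \<inter> V) = S \<inter> T" using V by blast
    moreover have "sdim (join S (T \<inter> V)) + sdim (S \<inter> (T \<inter> V)) = sdim S + sdim (T \<inter> V)"
      by (rule less.hyps) (use TVd sTV sJ dim_ge[OF sTV] in auto)
    ultimately show ?thesis using TVd by simp
  qed
qed

subsection \<open>Cliques and independent sets in Grassmann graphs\<close>

abbreviation G :: "int \<Rightarrow> 'a set set" where "G \<equiv> polar_grass P L"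
abbreviation adj :: "int \<Rightarrow> 'a set \<Rightarrow> 'a set \<Rightarrow> bool"
  where "adj \<equiv> grass_adj P L"
abbreviation gspan :: "int \<Rightarrow> 'a set set \<Rightarrow> 'a set set" where
  "gspan j \<equiv> geom_span (polar_grass P L j) (grass_lines P L j)"
abbreviation gindep :: "int \<Rightarrow> 'a set set \<Rightarrow> bool" where
  "gindep j \<equiv> geom_independent (polar_grass P L j) (grass_lines P L j)"

lemma G_sing: "S \<in> G j \<Longrightarrow> sing S"
  by (simp add: grass_iff)

lemma G_eq: "S \<in> G j \<Longrightarrow> T \<in> G j \<Longrightarrow>
  S \<subseteq> T \<Longrightarrow> S = T"
  using dim_eq by (simp add: grass_iff)

lemma collinear_set_Un: "sing S \<Longrightarrow> sing U \<Longrightarrow>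
  collinear_set (S \<union> U) \<longleftrightarrow> (\<forall>p\<in>S. \<forall>q\<in>U. col p q)"
  using sing_col by (auto simp: collinear_set_def intro: col_sym)

lemma adj_iff: "adj j S U \<longleftrightarrow> S \<in> G j \<and> U \<in> G j \<and>
  sdim (S \<inter> U) = j - 1 \<and> collinear_set (S \<union> U)"
  using collinear_set_Un has_dim_iff sing_Int by (auto simp: grass_adj_def grass_iff)

lemma adj_G: "adj j S U \<Longrightarrow> S \<in> G j" "adj j S U \<Longrightarrow> U \<in> G j"
  by (auto simp: adj_iff)

lemma adj_sym: "adj j S U \<Longrightarrow> adj j U S"
  by (simp add: adj_iff Int_commute Un_commute)

lemma adj_ne: "adj j S U \<Longrightarrow> S \<noteq> U"
  by (auto simp: adj_iff grass_iff)

lemma adj_Int: "adj j S U \<Longrightarrow> S \<inter> U \<in> G (j - 1)"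
  using sing_Int by (auto simp: adj_iff grass_iff)

lemma adj_join: "adj j S U \<Longrightarrow> join S U \<in> G (j + 1)"
  using modular[of S U] sing_join[of S U] by (auto simp: adj_iff grass_iff)

text \<open>Two different hyperplanes of \<open>W\<close> already span \<open>W\<close>, and the
  modular law then gives the dimension of their intersection. The dual situation is
  \<open>in_star\<close>.\<close>

lemma in_join:
  assumes "S \<in> G j" "U \<in> G j" "S \<noteq> U" "W \<in> G (j + 1)" "S \<subseteq> W"
    "U \<subseteq> W"
  shows "adj j S U" "join S U = W"
proof -
  have s: "sing S" "sing U" "sing W" using assms G_sing by auto
  have sj: "sing (join S U)" using sing_join_in s assms by blast
  have jW: "join S U \<subseteq> W" using join_least s assms by blast
  have "\<not> U \<subseteq> S" using G_eq assms by blast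
  then have "S \<subset> join S U" using join_sub[where S=S and T=U] by blast
  then have "sdim S < sdim (join S U)" using dim_psubset s sj by blast
  then have "sdim W \<le> sdim (join S U)" using assms by (simp add: grass_iff)
  then show j: "join S U = W" using dim_eq[OF sj s(3) jW] by blast
  have "collinear_set (S \<union> U)" using sing_collinear_set[OF s(3)] collinear_set_mono assms
    by (metis Un_least)
  then show "adj j S U"
    using modular[of S U] s assms j by (auto simp: adj_iff grass_iff)
qed

lemma in_star:
  assumes "S \<in> G j" "U \<in> G j" "S \<noteq> U" "A \<in> G (j - 1)" "A \<subseteq> S"
    "A \<subseteq> U" "collinear_set (S \<union> U)"
  shows "adj j S U" "S \<inter> U = A"
proof -
  have s: "sing S" "sing U" "sing A" using assms G_sing by auto
  have "\<not> S \<subseteq> U" using G_eq assms by blast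
  then have "sdim (S \<inter> U) < sdim S" using dim_psubset[of "S \<inter> U" S] sing_Int s
    by blast
  moreover have "sdim A \<le> sdim (S \<inter> U)"
    using dim_mono[of A "S \<inter> U"] sing_Int s assms by blast
  ultimately have d: "sdim (S \<inter> U) = j - 1" using assms by (simp add: grass_iff)
  then show "adj j S U" using assms by (simp add: adj_iff)
  show "S \<inter> U = A" using dim_eq[of A "S \<inter> U"] s sing_Int d assms
    by (simp add: grass_iff)
qed

text \<open>\<open>S3\<close> meets \<open>S1\<close> and \<open>S2\<close> in different
  hyperplanes, for a common one would be \<open>S1 \<inter> S2\<close>. These two hyperplanes span
  \<open>S3\<close> and lie in \<open>join S1 S2\<close>.\<close>

lemma triangle:
  assumes "adj j S1 S2" "adj j S1 S3" "adj j S2 S3" "\<not> S1 \<inter> S2 \<subseteq> S3"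
  shows "S3 \<subseteq> join S1 S2"
proof -
  have g: "S1 \<inter> S3 \<in> G (j - 1)" "S2 \<inter> S3 \<in> G (j - 1)"
    "S1 \<inter> S2 \<in> G (j - 1)" "S3 \<in> G (j - 1 + 1)"
    using adj_Int adj_G assms by auto
  have "S1 \<inter> S3 \<noteq> S2 \<inter> S3"
  proof
    assume "S1 \<inter> S3 = S2 \<inter> S3"
    then have "S1 \<inter> S3 \<subseteq> S1 \<inter> S2" by blast
    then have "S1 \<inter> S3 = S1 \<inter> S2" using G_eq g by blast
    then show False using assms(4) by blast
  qed
  then have "join (S1 \<inter> S3) (S2 \<inter> S3) = S3"
    using in_join(2)[OF g(1,2) _ g(4)] by blast
  moreover have "join (S1 \<inter> S3) (S2 \<inter> S3) \<subseteq> join S1 S2"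
    unfolding join_def by (intro geom_span_mono) auto
  ultimately show ?thesis by simp
qed

text \<open>Suppose \<open>F3\<close> is outside \<open>join F1 F2\<close>; then it contains
  \<open>F1 \<inter> F2\<close>, which therefore equals \<open>F1 \<inter> F3\<close>. A member
  \<open>F4\<close> not containing this subspace would lie in both \<open>join F1 F2\<close> and
  \<open>join F1 F3\<close>. Each of them is then \<open>join F1 F4\<close>, which puts
  \<open>F3\<close> into \<open>join F1 F2\<close>.\<close>

lemma clique_cases:
  assumes C: "\<And>F H. F \<in> C \<Longrightarrow> H \<in> C \<Longrightarrow>
    F \<noteq> H \<Longrightarrow> adj j F H"
    and F: "F1 \<in> C" "F2 \<in> C" "F1 \<noteq> F2"
  shows "(\<exists>W\<in>G (j + 1). \<forall>F\<in>C. F \<subseteq> W) \<or> (\<exists>A\<in>G (j - 1). \<forall>F\<in>C. A \<subseteq> F)"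
proof (cases "\<forall>F\<in>C. F \<subseteq> join F1 F2")
  case True
  moreover have "join F1 F2 \<in> G (j + 1)" using adj_join C F by blast
  ultimately show ?thesis by blast
next
  case False
  then obtain F3 where F3: "F3 \<in> C" "\<not> F3 \<subseteq> join F1 F2" by blast
  have ne: "F3 \<noteq> F1" "F3 \<noteq> F2" using F3 join_sub by blast+
  have a: "adj j F1 F2" "adj j F1 F3" "adj j F2 F3" using C F F3 ne by auto
  have S3: "F1 \<inter> F2 \<subseteq> F3" using triangle[OF a] F3 by blast
  have "F1 \<inter> F2 \<subseteq> F4" if F4: "F4 \<in> C" for F4
  proof (rule ccontr)
    assume n: "\<not> F1 \<inter> F2 \<subseteq> F4"
    then have ne4: "F4 \<noteq> F1" "F4 \<noteq> F2" "F4 \<noteq> F3" using S3 by blast+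
    have b: "adj j F1 F4" "adj j F2 F4" "adj j F3 F4" using C F F3 F4 ne4 by auto
    have 1: "F4 \<subseteq> join F1 F2" using triangle[OF a(1) b(1,2) n] .
    have "F1 \<inter> F3 = F1 \<inter> F2" using G_eq[OF adj_Int[OF a(1)] adj_Int[OF a(2)]] S3
      by blast
    then have 2: "F4 \<subseteq> join F1 F3" using triangle[OF a(2) b(1,3)] n by blast
    have "join F1 F3 = join F1 F4"
      using in_join(2)[OF adj_G[OF b(1)] ne4(1)[symmetric] adj_join[OF a(2)]] 2 join_sub[of F1 F3]
        by simp
    moreover have "join F1 F2 = join F1 F4"
      using in_join(2)[OF adj_G[OF b(1)] ne4(1)[symmetric] adj_join[OF a(1)]] 1 join_sub[of F1 F2]
        by simp
    ultimately show False using F3 join_sub[of F3 F1] join_comm by metis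
  qed
  then show ?thesis using adj_Int[OF a(1)] by blast
qed

text \<open>
  Otherwise \<open>S1\<close> is spanned by its intersections with \<open>S2\<close> and \<open>S4\<close>, hence collinear with \<open>S3\<close>, and the
  join of \<open>S1\<close> and \<open>S3\<close> has no room to have dimension above \<open>j + 1\<close>.
\<close>

lemma four_cycle:
  assumes "adj j S1 S2" "adj j S2 S3" "adj j S3 S4" "adj j S4 S1" "S1 \<noteq> S3"
    "\<not> adj j S1 S3"
    and j: "j = int n - 2"
  shows "S1 \<inter> S2 = S1 \<inter> S4"
proof (rule ccontr)
  assume ne: "S1 \<inter> S2 \<noteq> S1 \<inter> S4"
  have g: "S1 \<in> G j" "S3 \<in> G j" using assms adj_G by auto
  have "join (S1 \<inter> S2) (S1 \<inter> S4) = S1"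
    using in_join(2)[OF adj_Int[OF assms(1)] _ ne, of S1] adj_Int[OF adj_sym[OF assms(4)]] g by simp
  moreover have "join (S1 \<inter> S2) (S1 \<inter> S4) \<subseteq> perp S3"
    unfolding join_def
    using assms(2,3) g(1)[THEN G_sing, THEN sing_P]
    by (intro span_perp) (auto simp: adj_iff perp_def collinear_set_def)
  ultimately have "collinear_set (S1 \<union> S3)" using collinear_set_Un G_sing g
    by (auto simp: perp_def)
  then have sj: "sing (join S1 S3)" by (rule sing_join)
  have "\<not> S3 \<subseteq> S1" using G_eq g assms(5) by blast
  then have "S1 \<subset> join S1 S3" using join_sub by blast
  then have "sdim S1 < sdim (join S1 S3)" using dim_psubset G_sing g sj by blast
  moreover have "sdim (join S1 S3) \<le> j + 1" using dim_le[OF sj] j by simp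
  ultimately have "join S1 S3 \<in> G (j + 1)" using g sj by (simp add: grass_iff)
  then show False using in_join(1)[OF g assms(5)] join_sub assms(6) by blast
qed

section \<open>Spans and independence in the Grassmann space\<close>

lemma gspan_line:
  assumes "A \<in> G (j - 1)" "W \<in> G (j + 1)" "F1 \<in> gspan j E" "F2 \<in> gspan j E"
    "F1 \<noteq> F2"
    "F1 \<in> G j" "F2 \<in> G j" "F3 \<in> G j" "A \<subseteq> F1" "A \<subseteq> F2"
      "A \<subseteq> F3" "F1 \<subseteq> W" "F2 \<subseteq> W" "F3 \<subseteq> W"
  shows "F3 \<in> gspan j E"
proof (rule geom_span_closed[where p=F1 and q=F2])
  have "A \<subseteq> W" using assms by blast
  then show "grass_interval P L j A W \<in> grass_lines P L j"
    using assms(1,2) unfolding grass_lines_def by blast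
qed (use assms in \<open>auto simp: grass_interval_def\<close>)

lemma star_step:
  assumes A: "A \<in> G (j - 1)" and V: "sing V" "A \<subseteq> V"
    and H: "H \<in> G j" "A \<subseteq> H" "\<not> H \<subseteq> V"
    and M: "sing M" "V \<subseteq> M" "H \<subseteq> M"
  shows "V \<inter> H = A" "sdim (join V H) = sdim V + 1"
proof -
  have s: "sing (V \<inter> H)" using sing_Int V G_sing H by blast
  have "sdim (V \<inter> H) < sdim H" using dim_psubset[OF s] G_sing H by blast
  then show e: "V \<inter> H = A"
    using dim_eq[of A "V \<inter> H"] s A H V by (simp add: grass_iff)
  show "sdim (join V H) = sdim V + 1"
    using modular[OF V(1), of H] sing_join_in[OF M] e A H by (simp add: grass_iff)
qed

text \<open>The \<open>j\<close>-dimensional subspaces of \<open>M\<close> through \<open>A\<close>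
  behave like the points of a projective space. If \<open>V\<close> is the span of \<open>A\<close>
  and the earlier members, the Grassmann line through \<open>F\<close> and the new member
  \<open>H\<close> contains \<open>join F H \<inter> V\<close>, which is reached by
  induction.\<close>

lemma gspan_star:
  assumes A: "A \<in> G (j - 1)" and M: "sing M"
  shows "finite E \<Longrightarrow> (\<And>H. H \<in> E \<Longrightarrow> H \<in> G j \<and> A \<subseteq> H \<and> H \<subseteq> M) \<Longrightarrow> A \<subseteq> M \<Longrightarrow>
    F \<in> G j \<Longrightarrow> A \<subseteq> F \<Longrightarrow> F \<subseteq> span (A \<union> \<Union>E) \<Longrightarrow> F \<in> gspan j E"
proof (induction E arbitrary: F rule: finite_induct)
  case empty
  then have "F \<subseteq> A" using sing_span_eq[OF G_sing[OF A]] by simp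
  then have "sdim F \<le> sdim A" using dim_mono G_sing A empty by blast
  then show ?case using A empty by (simp add: grass_iff)
next
  case (insert H E)
  let ?V = "span (A \<union> \<Union>E)"
  have V: "sing ?V" "A \<subseteq> ?V" "?V \<subseteq> M"
  proof -
    have sub: "A \<union> \<Union>E \<subseteq> M" using insert.prems(1,2) by blast
    show "sing ?V" by (rule sing_span[OF collinear_set_mono[OF sing_collinear_set[OF M] sub]])
    show "?V \<subseteq> M" by (rule sing_least[OF M sub])
  qed auto
  have H: "H \<in> G j" "A \<subseteq> H" "H \<subseteq> M" using insert.prems by auto
  have mono: "gspan j E \<subseteq> gspan j (insert H E)" by (intro geom_span_mono) auto
  have IH: "D \<in> gspan j (insert H E)" if "D \<in> G j" "A \<subseteq> D" "D \<subseteq> ?V"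
    for D
    using insert.IH[of D] insert.prems that mono by auto
  have sub: "span (A \<union> \<Union>(insert H E)) \<subseteq> join ?V H"
    unfolding join_def by (intro geom_span_minimal) auto
  have sJ: "sing (join ?V H)" using sing_join_in[OF M V(3) H(3)] .
  show ?case
  proof (cases "F \<subseteq> ?V \<or> F = H")
    case True
    then show ?thesis using IH insert.prems by auto
  next
    case False
    have HV: "\<not> H \<subseteq> ?V"
    proof
      assume "H \<subseteq> ?V"
      then have "join ?V H \<subseteq> ?V" using join_least[OF V(1)] by blast
      moreover have "F \<subseteq> join ?V H" using insert.prems(5) sub by (rule subset_trans)
      ultimately show False using False by (meson subset_trans)
    qed
    note st = star_step[OF A V(1,2) H(1,2) HV M V(3) H(3)]
    have FJ: "F \<subseteq> join ?V H" using insert.prems(5) sub by (rule subset_trans)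
    have HJ: "H \<subseteq> join ?V H" "?V \<subseteq> join ?V H" using join_sub by auto
    have "collinear_set (F \<union> H)" using collinear_set_mono[OF sing_collinear_set[OF sJ]] FJ HJ
      by (metis Un_least)
    then have FH: "adj j F H" using in_star(1)[of F j H A] insert.prems H False A by blast
    let ?K = "join F H"
    have K: "?K \<in> G (j + 1)" using adj_join[OF FH] .
    have KJ: "?K \<subseteq> join ?V H" using join_least[OF sJ FJ HJ(1)] .
    have FK: "F \<subseteq> ?K" "H \<subseteq> ?K" using join_sub by auto
    have "sdim (?K \<inter> ?V) = j"
      using hyperplane_Int[OF V(1) sJ HJ(2) st(2) G_sing[OF K] KJ] K FK False
        by (auto simp: grass_iff)
    then have D: "?K \<inter> ?V \<in> G j" using sing_Int G_sing[OF K] V by (auto simp: grass_iff)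
    have AD: "A \<subseteq> ?K \<inter> ?V" using V H FK by blast
    have in_span: "?K \<inter> ?V \<in> gspan j (insert H E)" using IH[OF D AD] by blast
    have ne: "H \<noteq> ?K \<inter> ?V" using HV by blast
    show ?thesis
      by (rule gspan_line[OF A K, where ?F1.0=H and ?F2.0="?K \<inter> ?V"]) (use in_span ne D AD H FK insert.prems in auto)
  qed
qed

text \<open>By \<open>gspan_star\<close>, a member outside the Grassmann span of the earlier ones is
  not contained in their join, so it raises the dimension by one. As dimensions are bounded by the
  rank, this limits the size of independent star cliques.\<close>

lemma dim_indep_star:
  assumes A: "A \<in> G (j - 1)" and M: "sing M" "A \<subseteq> M"
  shows "finite E \<Longrightarrow> (\<And>H. H \<in> E \<Longrightarrow> H \<in> G j \<and> A \<subseteq> H \<and> H \<subseteq> M) \<Longrightarrow> gindep j E \<Longrightarrow>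
    sdim (span (A \<union> \<Union>E)) = j - 1 + int (card E)"
proof (induction E rule: finite_induct)
  case empty
  then show ?case using sing_span_eq A by (simp add: grass_iff)
next
  case (insert H E)
  let ?V = "span (A \<union> \<Union>E)"
  have V: "sing ?V" "A \<subseteq> ?V" "?V \<subseteq> M"
  proof -
    have sub: "A \<union> \<Union>E \<subseteq> M" using insert.prems(1) M(2) by blast
    show "sing ?V" by (rule sing_span[OF collinear_set_mono[OF sing_collinear_set[OF M(1)] sub]])
    show "?V \<subseteq> M" by (rule sing_least[OF M(1) sub])
  qed auto
  have H: "H \<in> G j" "A \<subseteq> H" "H \<subseteq> M" using insert.prems by auto
  have "H \<notin> gspan j E"
    using insert.prems(2) insert.hyps by (auto simp: geom_independent_iff)
  then have HV: "\<not> H \<subseteq> ?V"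
    using gspan_star[OF A M(1) insert.hyps(1) _ M(2) H(1,2)] insert.prems by blast
  have "A \<union> \<Union>(insert H E) = H \<union> (A \<union> \<Union>E)" by blast
  then have "span (A \<union> \<Union>(insert H E)) = join ?V H"
    unfolding join_def using geom_span_Un_span[of P L H "A \<union> \<Union>E"]
      by (simp add: Un_commute)
  moreover have "sdim ?V = j - 1 + int (card E)"
    using insert.IH insert.prems geom_independent_subset[OF insert.prems(2), of E] by auto
  ultimately show ?case
    using star_step(2)[OF A V(1,2) H(1,2) HV M(1) V(3) H(3)] insert.hyps by simp
qed

text \<open>The factor \<open>W\<close> matters when \<open>E\<close> is empty, since
  \<open>\<Inter>{}\<close> is the whole type.\<close>

lemma sing_Int_Inter:
  assumes "sing W" "\<And>H. H \<in> E \<Longrightarrow> sing H"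
  shows "sing (W \<inter> \<Inter>E)"
proof -
  have "geom_subspace P L (W \<inter> \<Inter>E)"
    unfolding geom_subspace_def
  proof (intro conjI ballI impI)
    show "W \<inter> \<Inter>E \<subseteq> P" using sing_P assms by blast
    fix l p q assume "l \<in> L" "p \<in> W \<inter> \<Inter>E" "q \<in> W \<inter> \<Inter>E"
      "p \<noteq> q" "p \<in> l" "q \<in> l"
    then have "l \<subseteq> W" "\<And>H. H \<in> E \<Longrightarrow> l \<subseteq> H"
      using sing_line[of _ l p q] assms by auto
    then show "l \<subseteq> W \<inter> \<Inter>E" by blast
  qed
  then show ?thesis using sing_subspace[OF assms(1)] by blast
qed

text \<open>Dual to \<open>gspan_star\<close>, inside \<open>W\<close>. If \<open>V\<close>, the
  intersection of the earlier members, is not in \<open>F\<close>, then \<open>F\<close> is on the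
  Grassmann line from \<open>F \<inter> H\<close> to \<open>W\<close>, which also carries
  \<open>H\<close> and \<open>join (F \<inter> H) V\<close>. The latter has dimension
  \<open>j\<close> because \<open>F \<inter> H\<close> meets \<open>V\<close> in the hyperplane
  \<open>V \<inter> H\<close>, and it contains \<open>V\<close>.\<close>

lemma gspan_top:
  assumes W: "W \<in> G (j + 1)"
  shows "finite E \<Longrightarrow> (\<And>H. H \<in> E \<Longrightarrow> H \<in> G j \<and> H \<subseteq> W) \<Longrightarrow>
    F \<in> G j \<Longrightarrow> F \<subseteq> W \<Longrightarrow> W \<inter> \<Inter>E \<subseteq> F \<Longrightarrow> F \<in> gspan j E"
proof (induction E arbitrary: F rule: finite_induct)
  case empty
  then have "F = W" by auto
  then show ?case using W empty by (simp add: grass_iff)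
next
  case (insert H E)
  let ?V = "W \<inter> \<Inter>E"
  have sW: "sing W" using W G_sing by blast
  have "\<And>K. K \<in> E \<Longrightarrow> sing K" using insert.prems(1) G_sing by blast
  then have V: "sing ?V" by (rule sing_Int_Inter[OF sW])
  have H: "H \<in> G j" "H \<subseteq> W" using insert.prems by auto
  have mono: "gspan j E \<subseteq> gspan j (insert H E)" by (intro geom_span_mono) auto
  have IH: "D \<in> gspan j (insert H E)" if "D \<in> G j" "D \<subseteq> W" "?V \<subseteq> D"
    for D
    using insert.IH[of D] insert.prems that mono by auto
  have VHF: "?V \<inter> H \<subseteq> F" using insert.prems by auto
  show ?case
  proof (cases "?V \<subseteq> F \<or> F = H")
    case True
    then show ?thesis using IH insert.prems by auto
  next
    case False
    then have VH: "\<not> ?V \<subseteq> H" using VHF by blast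
    have FH: "adj j F H" using in_join(1)[OF insert.prems(2) H(1) _ W insert.prems(3) H(2)] False
      by blast
    let ?D = "join (F \<inter> H) ?V"
    have A: "F \<inter> H \<in> G (j - 1)" using adj_Int[OF FH] .
    have sD: "sing ?D" by (rule sing_join_in[OF sW]) (use H in auto)
    have DW: "?D \<subseteq> W" by (rule join_least[OF sW]) (use H in auto)
    have "sdim (?V \<inter> H) = sdim ?V - 1"
      by (rule hyperplane_Int[OF G_sing[OF H(1)] sW H(2) _ V _ VH]) (use H W in \<open>auto simp: grass_iff\<close>)
    moreover have "F \<inter> H \<inter> ?V = ?V \<inter> H" using VHF by blast
    ultimately have "sdim ?D = j"
      using modular[OF G_sing[OF A] V sD] A by (simp add: grass_iff)
    then have D: "?D \<in> G j" using sD by (simp add: grass_iff)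
    have sub: "F \<inter> H \<subseteq> ?D" "?V \<subseteq> ?D" using join_sub by auto
    have in_span: "?D \<in> gspan j (insert H E)" using IH[OF D DW sub(2)] .
    have ne: "H \<noteq> ?D" using VH sub by auto
    show ?thesis
      by (rule gspan_line[OF A W, where ?F1.0=H and ?F2.0="?D"]) (use in_span ne D DW sub(1) H insert.prems(2,3) in simp_all)
  qed
qed

text \<open>Each further independent hyperplane of \<open>W\<close> cuts the intersection down by
  exactly one dimension. All dimensions in the reconstruction of the apartment come from
  here.\<close>

lemma dim_indep_top:
  assumes W: "W \<in> G (j + 1)"
  shows "finite E \<Longrightarrow> (\<And>H. H \<in> E \<Longrightarrow> H \<in> G j \<and> H \<subseteq> W) \<Longrightarrow> gindep j E \<Longrightarrow>
    sdim (W \<inter> \<Inter>E) = j + 1 - int (card E)"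
proof (induction E rule: finite_induct)
  case empty
  then show ?case using W by (simp add: grass_iff)
next
  case (insert H E)
  let ?V = "W \<inter> \<Inter>E"
  have sW: "sing W" using W G_sing by blast
  have "\<And>K. K \<in> E \<Longrightarrow> sing K" using insert.prems(1) G_sing by blast
  then have V: "sing ?V" by (rule sing_Int_Inter[OF sW])
  have H: "H \<in> G j" "H \<subseteq> W" using insert.prems by auto
  have "H \<notin> gspan j E"
    using insert.prems(2) insert.hyps by (auto simp: geom_independent_iff)
  then have VH: "\<not> ?V \<subseteq> H"
    using gspan_top[OF W insert.hyps(1) _ H] insert.prems by blast
  have "sdim (?V \<inter> H) = sdim ?V - 1"
    by (rule hyperplane_Int[OF G_sing[OF H(1)] sW H(2) _ V _ VH]) (use H W in \<open>auto simp: grass_iff\<close>)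
  moreover have "W \<inter> \<Inter>(insert H E) = ?V \<inter> H" by blast
  moreover have "sdim ?V = j + 1 - int (card E)"
    using insert.IH insert.prems geom_independent_subset[OF insert.prems(2), of E] by auto
  ultimately show ?case using insert.hyps by simp
qed

end

section \<open>Maximal cliques of polar Johnson graphs\<close>

lemma PJ_singular_insert:
  "PJ_singular l (insert x A) \<longleftrightarrow> 1 \<le> \<bar>x\<bar> \<and>
    \<bar>x\<bar> \<le> int l \<and> - x \<notin> A \<and> PJ_singular l A"
  unfolding PJ_singular_def by auto

lemma PJ_singular_subset: "PJ_singular l B \<Longrightarrow> A \<subseteq> B \<Longrightarrow>
  PJ_singular l A"
  by (auto simp: PJ_singular_def)

lemma PJ_singular_empty: "PJ_singular l {}"
  by (simp add: PJ_singular_def)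

lemma PJ_singular_abs:
  assumes "PJ_singular l A"
  shows "inj_on abs A" "abs ` A \<subseteq> {1..int l}"
proof -
  show "inj_on abs A"
  proof (rule inj_onI)
    fix x y assume "x \<in> A" "y \<in> A" "\<bar>x\<bar> = \<bar>y\<bar>"
    then show "x = y" using assms unfolding PJ_singular_def by (metis abs_eq_iff)
  qed
  show "abs ` A \<subseteq> {1..int l}" using assms by (auto simp: PJ_singular_def)
qed

lemma PJ_singular_finite: "PJ_singular l A \<Longrightarrow> finite A"
  using PJ_singular_abs finite_subset finite_imageD by (metis finite_atLeastAtMost_int)

lemma PJ_singular_extend:
  assumes "PJ_singular l A"
  shows "\<exists>M. A \<subseteq> M \<and> PJ_singular l M \<and> card M = l"
proof -
  \<comment> \<open>Every coordinate that occurs in \<open>A\<close> with neither sign is added with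
    the positive sign.\<close>
  let ?M = "A \<union> {c. 1 \<le> c \<and> c \<le> int l \<and> c \<notin> A \<and>
    - c \<notin> A}"
  have M: "PJ_singular l ?M" using assms by (auto simp: PJ_singular_def)
  have "{1..int l} \<subseteq> abs ` ?M"
  proof
    fix c :: int assume c: "c \<in> {1..int l}"
    show "c \<in> abs ` ?M"
    proof (cases "c \<in> A \<or> - c \<in> A")
      case True
      then show ?thesis using c by (auto intro: rev_image_eqI)
    next
      case False
      then show ?thesis using c by (intro rev_image_eqI[of c]) auto
    qed
  qed
  then have "abs ` ?M = {1..int l}" using PJ_singular_abs(2)[OF M] by blast
  then have "card ?M = l" using card_image[OF PJ_singular_abs(1)[OF M]] by simp
  then show ?thesis using M by blast
qed

lemma PJ_singular_total:
  assumes "PJ_singular l M" "card M = l" "1 \<le> \<bar>x\<bar>" "\<bar>x\<bar> \<le> int l"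
  shows "x \<in> M \<or> - x \<in> M"
proof -
  have "card (abs ` M) = card {1..int l}"
    using card_image[OF PJ_singular_abs(1)[OF assms(1)]] assms(2) by simp
  then have "abs ` M = {1..int l}"
    using PJ_singular_abs(2)[OF assms(1)] by (intro card_subset_eq) auto
  then have "\<bar>x\<bar> \<in> abs ` M" using assms by auto
  then show ?thesis by (auto simp: abs_eq_iff)
qed

lemma free_coordinate:
  assumes "finite Z" "card Z < l"
  shows "\<exists>c. 1 \<le> \<bar>c\<bar> \<and> \<bar>c\<bar> \<le> int l \<and>
    c \<notin> Z \<and> - c \<notin> Z"
proof -
  have "card (abs ` Z) < card {1..int l}" using card_image_le[OF assms(1), of abs] assms(2) by simp
  then have "\<not> {1..int l} \<subseteq> abs ` Z" using card_mono assms(1)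
    by (metis finite_imageI linorder_not_less)
  then obtain c where "c \<in> {1..int l}" "c \<notin> abs ` Z" by blast
  then show ?thesis by (intro exI[of _ c]) (auto intro: rev_image_eqI)
qed

text \<open>Singular sets of one size containing \<open>A\<close> are connected by exchanges of one
  element. To approach \<open>D'\<close>, an element \<open>y\<close> of \<open>D' - D\<close>
  replaces an element of \<open>D - D'\<close>; if \<open>- y\<close> is in \<open>D\<close>, it is
  the one removed, which keeps the set singular. Elements of \<open>A\<close> lie in
  \<open>D'\<close> and are never removed.\<close>

lemma swap_connected:
  assumes step: "\<And>E x y. PJ_singular l E \<Longrightarrow> card E = c \<Longrightarrow> A \<subseteq> E - {x} \<Longrightarrow> x \<in> E \<Longrightarrow> y \<notin> E \<Longrightarrow>
      PJ_singular l (insert y (E - {x})) \<Longrightarrow> R E \<Longrightarrow> R (insert y (E - {x}))"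
    and D': "PJ_singular l D'" "card D' = c" "A \<subseteq> D'"
  shows "PJ_singular l D \<Longrightarrow> card D = c \<Longrightarrow>
    A \<subseteq> D \<Longrightarrow> R D \<Longrightarrow> R D'"
proof (induction "card (D' - D)" arbitrary: D rule: less_induct)
  case less
  have fin: "finite D" "finite D'" using PJ_singular_finite less.prems D' by auto
  show ?case
  proof (cases "D' \<subseteq> D")
    case True
    then have "D' = D" using card_subset_eq fin less.prems D' by metis
    then show ?thesis using less.prems by simp
  next
    case False
    then obtain y where y: "y \<in> D'" "y \<notin> D" by blast
    have "\<not> D \<subseteq> D'" using card_subset_eq[OF fin(2)] less.prems D' False by auto
    moreover have "- y \<notin> D'" using D'(1) y by (auto simp: PJ_singular_def)
    ultimately obtain x where x: "x \<in> D" "x \<notin> D'" "- y \<in> D \<Longrightarrow> x = - y"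
      by blast
    let ?E = "insert y (D - {x})"
    have sE: "PJ_singular l ?E"
      unfolding PJ_singular_insert using D'(1) y x
        PJ_singular_subset[OF less.prems(1), of "D - {x}"]
      by (auto simp: PJ_singular_def)
    have cE: "card ?E = c" using fin x y less.prems
      by (metis Diff_iff card_Suc_Diff1 card_insert_disjoint finite_Diff)
    have "D' - ?E = D' - D - {y}" using x by auto
    then have lt: "card (D' - ?E) < card (D' - D)" using y fin
      by (metis Diff_iff card_Diff1_less finite_Diff)
    have "R ?E" using step less.prems x y sE D'(3) by blast
    then show ?thesis using less.hyps[OF lt sE cE] less.prems(3) D'(3) x by blast
  qed
qed

lemma PJ_adj_iff:
  "m + 2 \<le> l \<Longrightarrow> PJ_adj l m A B \<longleftrightarrow>
    PJ_singular l (A \<union> B) \<and> card A = m + 1 \<and> card B = m + 1 \<and> card (A \<inter> B) = m"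
  using PJ_singular_subset[of l "A \<union> B"] by (auto simp: PJ_adj_def PJ_vertices_def)

lemma graph_cliqueD: "graph_clique W E C \<Longrightarrow> x \<in> C \<Longrightarrow>
  y \<in> C \<Longrightarrow> x \<noteq> y \<Longrightarrow> E x y"
  by (simp add: graph_clique_def)

lemma PJ_adj_insert:
  assumes "m + 2 \<le> l" "PJ_singular l (insert x (insert y A))" "card A = m" "x \<notin> A"
    "y \<notin> A" "x \<noteq> y"
  shows "PJ_adj l m (insert x A) (insert y A)"
proof -
  have "finite A" using PJ_singular_finite[OF assms(2)] by simp
  moreover have "insert x A \<inter> insert y A = A"
    "insert x A \<union> insert y A = insert x (insert y A)"
    using assms by auto
  ultimately show ?thesis using assms by (simp add: PJ_adj_iff)
qed

lemma PJ_adj_remove: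
  assumes "m + 2 \<le> l" "PJ_singular l D" "card D = m + 2" "x \<in> D" "y \<in> D" "x \<noteq> y"
  shows "PJ_adj l m (D - {x}) (D - {y})"
proof -
  have c: "card (D - {x,y}) = m" using assms PJ_singular_finite[OF assms(2)]
    by (simp add: card_Diff_subset)
  have e: "insert y (D - {x,y}) = D - {x}" "insert x (D - {x,y}) = D - {y}" "insert y (D - {y}) = D"
    using assms by auto
  show ?thesis
    using PJ_adj_insert[OF assms(1) _ c, of y x] assms(2,6) unfolding e by auto
qed

lemma PJ_vertices_remove: "PJ_singular l D \<Longrightarrow> card D = m + 2 \<Longrightarrow>
  x \<in> D \<Longrightarrow> D - {x} \<in> PJ_vertices l m"
  using PJ_singular_subset[of l D "D - {x}"] PJ_singular_finite[of l D]
    by (auto simp: PJ_vertices_def)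

text \<open>A vertex \<open>B\<close> adjacent to every \<open>D - {x}\<close> and contained in
  \<open>D\<close> would itself be of this form. If \<open>B\<close> is not contained in
  \<open>D\<close>, it has at most \<open>m\<close> elements in \<open>D\<close> and still
  \<open>m\<close> in each \<open>D - {x}\<close>; so it avoids every \<open>x\<close> in
  \<open>D\<close>, contrary to \<open>m > 0\<close>.\<close>

lemma PJ_top_maximal:
  assumes ml: "0 < m" "m + 2 \<le> l" and D: "PJ_singular l D" "card D = m + 2"
  shows "maximal_clique (PJ_vertices l m) (PJ_adj l m) ((\<lambda>x. D - {x}) ` D)"
proof -
  let ?C = "(\<lambda>x. D - {x}) ` D"
  have fD: "finite D" using PJ_singular_finite D by blast
  have "graph_clique (PJ_vertices l m) (PJ_adj l m) ?C"
    unfolding graph_clique_def using PJ_vertices_remove[OF D] PJ_adj_remove[OF ml(2) D] by fastforce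
  moreover have "E = ?C" if E: "graph_clique (PJ_vertices l m) (PJ_adj l m) E" "?C \<subseteq> E"
    for E
  proof
    show "E \<subseteq> ?C"
    proof
      fix B assume B: "B \<in> E"
      show "B \<in> ?C"
      proof (rule ccontr)
        assume nB: "B \<notin> ?C"
        have Bc: "card B = m + 1" "finite B"
          using B E PJ_singular_finite by (auto simp: graph_clique_def PJ_vertices_def)
        have c: "card (B \<inter> (D - {x})) = m" if "x \<in> D" for x
        proof -
          have "D - {x} \<in> E" "B \<noteq> D - {x}" using E that nB by auto
          then have "PJ_adj l m B (D - {x})" using graph_cliqueD[OF E(1) B] by blast
          then show ?thesis unfolding PJ_adj_iff[OF ml(2)] by blast
        qed
        show False
        proof (cases "B \<subseteq> D")
          case True
          then have "card (D - B) = 1" using Bc D fD by (simp add: card_Diff_subset)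
          then obtain x where "D - B = {x}" by (meson card_1_singletonE)
          then have "B = D - {x}" "x \<in> D" using True by auto
          then show False using nB by blast
        next
          case False
          then have "card (B \<inter> D) < card B" using Bc by (intro psubset_card_mono) auto
          then have "card (B \<inter> D) \<le> m" using Bc by simp
          have e: "B \<inter> (D - {x}) = B \<inter> D" if "x \<in> D" for x
          proof -
            have "card (B \<inter> (D - {x})) \<le> card (B \<inter> D)" using fD
              by (intro card_mono) auto
            then have "card (B \<inter> (D - {x})) = card (B \<inter> D)"
              using c[OF that] \<open>card (B \<inter> D) \<le> m\<close> by simp
            then show ?thesis using fD by (intro card_subset_eq) auto
          qed
          have "B \<inter> D = {}" using e by blast
          moreover have "D \<noteq> {}" using D by auto
          ultimately show False using c e ml by fastforce
        qed
      qed
    qed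
  qed (rule E(2))
  ultimately show ?thesis unfolding maximal_clique_def by blast
qed

text \<open>A further vertex \<open>B\<close> containing \<open>A\<close> is
  \<open>insert z A\<close> with \<open>- z\<close> in \<open>M - A\<close>, which conflicts with
  adjacency to \<open>insert (- z) A\<close>. If \<open>B\<close> does not contain \<open>A\<close>,
  it contains \<open>M - A\<close> and \<open>m - 1\<close> elements of \<open>A\<close>, too many
  because \<open>M - A\<close> has at least three elements. For \<open>l = m + 2\<close> there would
  be only two, and the clique would extend to one inside \<open>M\<close>.\<close>

lemma PJ_star_maximal:
  assumes ml: "m + 3 \<le> l" and M: "PJ_singular l M" "card M = l"
    and A: "A \<subseteq> M" "card A = m"
  shows "maximal_clique (PJ_vertices l m) (PJ_adj l m) ((\<lambda>x. insert x A) ` (M - A))"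
proof -
  let ?C = "(\<lambda>x. insert x A) ` (M - A)"
  have fM: "finite M" "finite A" using PJ_singular_finite M A finite_subset by blast+
  have ml2: "m + 2 \<le> l" using ml by simp
  have v: "insert x A \<in> PJ_vertices l m" if "x \<in> M - A" for x
    using that A fM PJ_singular_subset[OF M(1), of "insert x A"] by (auto simp: PJ_vertices_def)
  have "PJ_adj l m (insert x A) (insert y A)" if "x \<in> M - A" "y \<in> M - A" "x \<noteq> y"
    for x y
    using that A PJ_singular_subset[OF M(1), of "insert x (insert y A)"]
      by (intro PJ_adj_insert ml2) auto
  then have "graph_clique (PJ_vertices l m) (PJ_adj l m) ?C"
    unfolding graph_clique_def using v by blast
  moreover have "E = ?C" if E: "graph_clique (PJ_vertices l m) (PJ_adj l m) E" "?C \<subseteq> E"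
    for E
  proof
    show "E \<subseteq> ?C"
    proof
      fix B assume B: "B \<in> E"
      show "B \<in> ?C"
      proof (rule ccontr)
        assume nB: "B \<notin> ?C"
        have Bc: "card B = m + 1" "finite B" "PJ_singular l B"
          using B E PJ_singular_finite by (auto simp: graph_clique_def PJ_vertices_def)
        have c: "card (B \<inter> insert x A) = m" "PJ_singular l (B \<union> insert x A)"
          if "x \<in> M - A" for x
        proof -
          have "insert x A \<in> E" "B \<noteq> insert x A" using E that nB by auto
          then have "PJ_adj l m B (insert x A)" using graph_cliqueD[OF E(1) B] by blast
          then show "card (B \<inter> insert x A) = m" "PJ_singular l (B \<union> insert x A)"
            unfolding PJ_adj_iff[OF ml2] by blast+
        qed
        have cM: "card (M - A) \<ge> 3" using ml A M fM by (simp add: card_Diff_subset)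
        show False
        proof (cases "A \<subseteq> B")
          case True
          then have "card (B - A) = 1" using Bc A fM by (simp add: card_Diff_subset)
          then obtain z where z: "B - A = {z}" by (meson card_1_singletonE)
          then have Bz: "B = insert z A" "z \<notin> A" using True by auto
          then have zM: "z \<notin> M" using nB by blast
          have "1 \<le> \<bar>z\<bar>" "\<bar>z\<bar> \<le> int l" "- z \<notin> A" using Bc(3)
            unfolding Bz(1) PJ_singular_insert by auto
          then have "- z \<in> M - A" using PJ_singular_total[OF M] zM by blast
          then have "PJ_singular l (B \<union> insert (- z) A)" using c by blast
          then show False using Bz by (auto simp: PJ_singular_def)
        next
          case False
          then have lt: "card (B \<inter> A) < m" using A fM psubset_card_mono[of A "B \<inter> A"]
            by auto
          have MB: "x \<in> B" if "x \<in> M - A" for x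
          proof (rule ccontr)
            assume "x \<notin> B"
            then have "B \<inter> insert x A = B \<inter> A" by auto
            then show False using c(1)[OF that] lt by simp
          qed
          obtain x where x: "x \<in> M - A" using cM
            by (metis card.empty equals0I not_numeral_le_zero)
          have "B \<inter> insert x A = insert x (B \<inter> A)" using MB x by auto
          then have BA: "card (B \<inter> A) + 1 = m" using c(1)[OF x] x fM by auto
          have "(M - A) \<union> (B \<inter> A) \<subseteq> B" using MB by blast
          then have "card ((M - A) \<union> (B \<inter> A)) \<le> m + 1" using card_mono Bc by metis
          moreover have "card ((M - A) \<union> (B \<inter> A)) = card (M - A) + card (B \<inter> A)"
            using fM by (intro card_Un_disjoint) auto
          ultimately show False using cM BA by linarith
        qed
      qed
    qed
  qed (rule E(2))
  ultimately show ?thesis unfolding maximal_clique_def by blast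
qed

context polar_geometry
begin

section \<open>The two types of triangles\<close>

definition triple_top :: "int \<Rightarrow> 'a set \<Rightarrow> 'a set \<Rightarrow> 'a set \<Rightarrow> bool" where
  "triple_top j S T U \<longleftrightarrow> (\<exists>W\<in>G (j + 1). S \<subseteq> W \<and>
    T \<subseteq> W \<and> U \<subseteq> W)"

definition triple_star :: "int \<Rightarrow> 'a set \<Rightarrow> 'a set \<Rightarrow> 'a set \<Rightarrow> bool" where
  "triple_star j S T U \<longleftrightarrow> (\<exists>A\<in>G (j - 1). A \<subseteq> S \<and>
    A \<subseteq> T \<and> A \<subseteq> U)"

lemma triple_top_perm: "triple_top j S T U \<Longrightarrow> triple_top j T S U"
  "triple_top j S T U \<Longrightarrow> triple_top j S U T"
  by (auto simp: triple_top_def)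

lemma triple_star_I: "adj j S T \<Longrightarrow> S \<inter> T \<subseteq> U \<Longrightarrow>
  triple_star j S T U"
  unfolding triple_star_def using adj_Int by (intro bexI[of _ "S \<inter> T"]) auto

lemma triple_top_or_triple_star:
  assumes "adj j S T" "adj j S U" "adj j T U"
  shows "triple_top j S T U \<or> triple_star j S T U"
proof (cases "S \<inter> T \<subseteq> U")
  case True
  then show ?thesis using triple_star_I[OF assms(1)] by blast
next
  case False
  then have "U \<subseteq> join S T" using triangle assms by blast
  then show ?thesis using adj_join[OF assms(1)] join_sub[where S=S and T=T] unfolding triple_top_def
    by blast
qed

lemma triple_top_join:
  assumes "adj j S T" "triple_top j S T U"
  shows "U \<subseteq> join S T"
  using assms in_join(2)[OF adj_G[OF assms(1)] adj_ne[OF assms(1)]] unfolding triple_top_def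
    by blast

lemma triple_star_Int:
  assumes "adj j S T" "adj j S U" "triple_star j S T U"
  shows "S \<inter> T = S \<inter> U"
proof -
  obtain A where A: "A \<in> G (j - 1)" "A \<subseteq> S" "A \<subseteq> T" "A \<subseteq> U"
    using assms(3) unfolding triple_star_def by blast
  have "S \<inter> T = A"
    using in_star(2)[OF adj_G[OF assms(1)] adj_ne[OF assms(1)] A(1-3)] assms(1)
      by (simp add: adj_iff)
  moreover have "S \<inter> U = A"
    using in_star(2)[OF adj_G[OF assms(2)] adj_ne[OF assms(2)] A(1,2,4)] assms(2)
      by (simp add: adj_iff)
  ultimately show ?thesis by simp
qed

lemma triple_top_adj:
  assumes "adj j S T" "triple_top j S T U" "triple_top j S T V" "U \<in> G j" "V \<in> G j"
    "U \<noteq> V"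
  shows "adj j U V"
  by (rule in_join(1)[OF assms(4-6) adj_join[OF assms(1)]]) (use triple_top_join assms(1-3) in auto)

text \<open>A triangle of both types is contained in one line of the Grassmann space, so
  \<open>U\<close> would be in the span of \<open>S\<close> and \<open>T\<close>.\<close>

lemma independent_triple:
  assumes "gindep j C" "{S, T, U} \<subseteq> C" "adj j S T" "adj j S U" "adj j T U"
    "triple_top j S T U"
  shows "\<not> triple_star j S T U"
proof
  assume "triple_star j S T U"
  then have i: "S \<inter> T \<subseteq> U" using triple_star_Int assms by blast
  have ne: "S \<noteq> T" "S \<noteq> U" "T \<noteq> U" using assms adj_ne by auto
  then have ST: "S \<in> gspan j (C - {U})" "T \<in> gspan j (C - {U})" using assms(2) by auto
  have "U \<in> gspan j (C - {U})"
    by (rule gspan_line[OF adj_Int[OF assms(3)] adj_join[OF assms(3)] ST ne(1)])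
      (use assms(3-6) adj_G i triple_top_join[OF assms(3,6)] join_sub(1)[of S T] join_sub(2)[of T S] in auto)
  then show False using assms(1,2) by (auto simp: geom_independent_iff)
qed

text \<open>
  In an octahedron of adjacent subspaces with independent faces, the faces lying in a common
  \<open>(j + 1)\<close>-dimensional subspace are either absent or every second one.
\<close>

lemma octahedron:
  assumes "adj j a b" "adj j a c" "adj j b c" "adj j a b'" "adj j a c'" "adj j b c'" "adj j b' c"
    "adj j b' c'"
    and "b \<noteq> b'" "c \<noteq> c'" "\<not> adj j b b'" "\<not> adj j c c'"
    and "triple_top j a b c" "\<not> triple_star j a b c"
  shows "triple_top j a b' c'"
proof (rule ccontr)
  assume "\<not> triple_top j a b' c'"
  then have 1: "triple_star j a b' c'" using triple_top_or_triple_star assms by blast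
  have g: "b \<in> G j" "b' \<in> G j" "c \<in> G j" "c' \<in> G j" using adj_G assms by blast+
  have "\<not> triple_top j a b c'" using triple_top_adj[OF assms(1,13) _ g(3,4)] assms by blast
  then have 2: "triple_star j a b c'" using triple_top_or_triple_star assms by blast
  have "\<not> triple_top j a c b'"
    using triple_top_adj[OF assms(2) triple_top_perm(2)[OF assms(13)] _ g(1,2)] assms by blast
  then have 3: "triple_star j a c b'" using triple_top_or_triple_star assms adj_sym by blast
  have "a \<inter> b' = a \<inter> c'" "a \<inter> b = a \<inter> c'" "a \<inter> c = a \<inter> b'"
    using triple_star_Int 1 2 3 assms by blast+
  then have "a \<inter> b \<subseteq> c" by blast
  then have "triple_star j a b c" using triple_star_I[OF assms(1)] by blast
  then show False using assms by blast
qed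

text \<open>If \<open>a\<close>, \<open>b\<close>, \<open>d\<close> formed a star, the triangle
  \<open>a\<close>, \<open>c\<close>, \<open>d\<close> would be contradictory: as a star it gives
  \<open>a \<inter> b = a \<inter> d = a \<inter> c\<close>, and as a top it puts \<open>d\<close>
  into \<open>join a c\<close>, which contains \<open>b\<close>.\<close>

lemma triple_top_extend:
  assumes "adj j a b" "adj j a c" "adj j b c" "adj j a d" "adj j b d" "adj j c d"
    and "triple_top j a b c" "\<not> triple_star j a b c"
  shows "triple_top j a b d"
proof (rule ccontr)
  assume n: "\<not> triple_top j a b d"
  then have 1: "triple_star j a b d" using triple_top_or_triple_star assms by blast
  show False
  proof (cases "triple_star j a c d")
    case True
    then have "a \<inter> b \<subseteq> c" using triple_star_Int 1 assms by blast
    then have "triple_star j a b c" using triple_star_I[OF assms(1)] by blast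
    then show False using assms by blast
  next
    case False
    then have "triple_top j a c d" using triple_top_or_triple_star assms by blast
    then have d: "d \<subseteq> join a c" using triple_top_join assms by blast
    have b: "b \<subseteq> join a c" using triple_top_join[OF assms(2)] triple_top_perm assms(7)
      by blast
    then show False using n d adj_join[OF assms(2)] join_sub(1)[of a c] unfolding triple_top_def
      by blast
  qed
qed

end

section \<open>Images of the cliques of \<open>PJ(l,m)\<close>\<close>

text \<open>The labelling \<open>f\<close> is a parameter, so that everything shown here applies
  again to \<open>f\<close> composed with an automorphism of \<open>PJ(4,1)\<close>. The rank
  condition is written with sums to avoid truncated subtraction.\<close>

locale PJ_embedding = polar_geometry P L n
  for P :: "'a set" and L :: "'a set set" and n :: nat +
  fixes k l m :: nat and f :: "int set \<Rightarrow> 'a set"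
  assumes m0: "0 < m" and ml: "m + 2 \<le> l" and rank_eq: "l + k = n + m"
    and f_G: "A \<in> PJ_vertices l m \<Longrightarrow> f A \<in> G (int k)"
    and f_inj: "inj_on f (PJ_vertices l m)"
    and f_adj: "A \<in> PJ_vertices l m \<Longrightarrow> B \<in> PJ_vertices l m \<Longrightarrow>
      adj (int k) (f A) (f B) \<longleftrightarrow> PJ_adj l m A B"
    and f_indep: "maximal_clique (PJ_vertices l m) (PJ_adj l m) C \<Longrightarrow>
      gindep (int k) (f ` C)"
begin

abbreviation sg :: "int set \<Rightarrow> bool" where "sg \<equiv> PJ_singular l"
abbreviation V :: "int set set" where "V \<equiv> PJ_vertices l m"

lemma V_iff: "A \<in> V \<longleftrightarrow> sg A \<and> card A = m + 1"
  by (simp add: PJ_vertices_def)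

lemma V_insert: "sg (insert x A) \<Longrightarrow> card A = m \<Longrightarrow>
  x \<notin> A \<Longrightarrow> insert x A \<in> V"
  using PJ_singular_finite[of l "insert x A"] by (simp add: V_iff)

lemma f_adj_insert:
  assumes "sg (insert x (insert y A))" "card A = m" "x \<notin> A" "y \<notin> A" "x \<noteq> y"
  shows "adj (int k) (f (insert x A)) (f (insert y A))"
proof -
  have "PJ_adj l m (insert x A) (insert y A)" using PJ_adj_insert[OF ml] assms by blast
  then show ?thesis using f_adj by (simp add: PJ_adj_def)
qed

lemma f_adj_remove:
  assumes "sg D" "card D = m + 2" "x \<in> D" "y \<in> D" "x \<noteq> y"
  shows "adj (int k) (f (D - {x})) (f (D - {y}))"
proof -
  have "PJ_adj l m (D - {x}) (D - {y})" using PJ_adj_remove[OF ml] assms by blast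
  then show ?thesis using f_adj by (simp add: PJ_adj_def)
qed

lemma f_nonadj:
  assumes "A \<in> V" "B \<in> V" "x \<in> A" "- x \<in> B"
  shows "\<not> adj (int k) (f A) (f B)" "f A \<noteq> f B"
proof -
  have "\<not> sg (A \<union> B)" using assms by (auto simp: PJ_singular_def)
  then show "\<not> adj (int k) (f A) (f B)" using f_adj assms PJ_adj_iff[OF ml] by simp
  have "A \<noteq> B" using assms by (auto simp: V_iff PJ_singular_def)
  then show "f A \<noteq> f B" using f_inj assms by (meson inj_on_def)
qed

lemma f_eq: "A \<in> V \<Longrightarrow> B \<in> V \<Longrightarrow> f A = f B \<longleftrightarrow>
  A = B"
  using f_inj by (meson inj_on_def)

section \<open>The types of the cliques in the image\<close>

lemma top_indep:
  assumes "sg D" "card D = m + 2"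
  shows "gindep (int k) ((\<lambda>x. f (D - {x})) ` D)"
  using f_indep[OF PJ_top_maximal[OF m0 ml assms]] by (simp add: image_image)

lemma independent_top_triple:
  assumes "sg D" "card D = m + 2" "{x, y, z} \<subseteq> D" "distinct [x, y, z]"
    and "triple_top (int k) (f (D - {x})) (f (D - {y})) (f (D - {z}))"
  shows "\<not> triple_star (int k) (f (D - {x})) (f (D - {y})) (f (D - {z}))"
  by (rule independent_triple[OF top_indep[OF assms(1,2)]]) (use assms f_adj_remove in auto)

lemma independent_star_triple:
  assumes "m + 3 \<le> l" "sg (insert x (insert y (insert z A)))" "card A = m" "x \<notin> A"
    "y \<notin> A" "z \<notin> A" "distinct [x, y, z]"
    and "triple_top (int k) (f (insert x A)) (f (insert y A)) (f (insert z A))"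
  shows "\<not> triple_star (int k) (f (insert x A)) (f (insert y A)) (f (insert z A))"
proof -
  obtain M where M: "insert x (insert y (insert z A)) \<subseteq> M" "sg M" "card M = l"
    using PJ_singular_extend[OF assms(2)] by blast
  have "gindep (int k) ((\<lambda>x. f (insert x A)) ` (M - A))"
    using f_indep[OF PJ_star_maximal[OF assms(1) M(2,3) _ assms(3)]] M(1)
      by (auto simp: image_image)
  moreover have "sg (insert x (insert y A))" "sg (insert x (insert z A))"
    "sg (insert y (insert z A))"
    using assms(2) by (simp_all add: PJ_singular_insert)
  ultimately show ?thesis
    by (intro independent_triple[where C="(\<lambda>x. f (insert x A)) ` (M - A)"])
      (use assms f_adj_insert M in auto)
qed

text \<open>The condition is vacuous for \<open>l = m + 2\<close>, because the three elements
  together with \<open>A\<close> form a singular set of size \<open>m + 3\<close>.\<close>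

definition star_triples :: bool where
  "star_triples \<longleftrightarrow> (\<forall>A x y z. sg (insert x (insert y (insert z A))) \<longrightarrow> card A = m \<longrightarrow>
     x \<notin> A \<longrightarrow> y \<notin> A \<longrightarrow> z \<notin> A \<longrightarrow> distinct [x, y, z] \<longrightarrow>
     triple_star (int k) (f (insert x A)) (f (insert y A)) (f (insert z A)))"

definition top_type :: "int set \<Rightarrow> bool" where
  "top_type D \<longleftrightarrow>
    (\<exists>W\<in>G (int k + 1). \<forall>x\<in>D. f (D - {x}) \<subseteq> W)"

definition all_tops :: bool where
  "all_tops \<longleftrightarrow> (\<forall>D. sg D \<longrightarrow>
    card D = m + 2 \<longrightarrow> top_type D)"

lemma top_or_star:
  assumes D: "sg D" "card D = m + 2"
  shows "top_type D \<or> (\<exists>S\<in>G (int k - 1). \<forall>x\<in>D. S \<subseteq> f (D - {x}))"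
proof -
  have "2 \<le> card D" using D by simp
  then obtain x y where xy: "x \<in> D" "y \<in> D" "x \<noteq> y"
    by (metis card_le_Suc0_iff_eq card.infinite not_less_eq_eq numeral_2_eq_2 le_zero_eq nat.simps(3))
  have "adj (int k) F H" if "F \<in> (\<lambda>x. f (D - {x})) ` D"
    "H \<in> (\<lambda>x. f (D - {x})) ` D" "F \<noteq> H" for F H
    using that f_adj_remove[OF D] by blast
  then show ?thesis
    using clique_cases[of "(\<lambda>x. f (D - {x})) ` D" "int k" "f (D - {x})" "f (D - {y})"] xy
      adj_ne[OF f_adj_remove[OF D xy]] unfolding top_type_def by auto
qed

text \<open>Star triangles give the claim unless \<open>z = - y\<close>, when the last two vertices
  are not adjacent. Then both are compared with a vertex \<open>insert c A\<close> for a coordinate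
  \<open>c\<close> not occurring in \<open>insert x (insert y A)\<close>;
  \<open>m + 3 \<le> l\<close> leaves room for it.\<close>

lemma star_Int_eq:
  assumes st: star_triples and l3: "m + 3 \<le> l"
    and A: "card A = m" "x \<notin> A" "y \<notin> A" "z \<notin> A" "x \<noteq> y" "x \<noteq> z"
    and s: "sg (insert x (insert y A))" "sg (insert x (insert z A))"
  shows "f (insert x A) \<inter> f (insert y A) = f (insert x A) \<inter> f (insert z A)"
proof -
  have tri: "f (insert x A) \<inter> f (insert y A) = f (insert x A) \<inter> f (insert z A)"
    if "sg (insert x (insert y (insert z A)))" "y \<notin> A" "z \<notin> A" "x \<noteq> y"
      "x \<noteq> z" "y \<noteq> z" for y z
  proof -
    have "sg (insert x (insert y A))" "sg (insert x (insert z A))"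
      using that(1) by (simp_all add: PJ_singular_insert)
    moreover have tr: "triple_star (int k) (f (insert x A)) (f (insert y A)) (f (insert z A))"
      using st that A unfolding star_triples_def by simp
    ultimately have "adj (int k) (f (insert x A)) (f (insert y A))"
      "adj (int k) (f (insert x A)) (f (insert z A))"
      using f_adj_insert A(1,2) that by auto
    then show ?thesis using triple_star_Int tr by blast
  qed
  show ?thesis
  proof (cases "z = y \<or> z \<noteq> - y")
    case True
    have "z = y \<or> sg (insert x (insert y (insert z A)))"
      using True s by (auto simp: PJ_singular_insert)
    then show ?thesis using tri A by blast
  next
    case False
    have fin: "finite A" using PJ_singular_finite[OF s(1)] by simp
    then obtain c where c: "1 \<le> \<bar>c\<bar>" "\<bar>c\<bar> \<le> int l"
      "c \<notin> insert x (insert y A)" "- c \<notin> insert x (insert y A)"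
      using free_coordinate[of "insert x (insert y A)" l] A l3 by auto
    have "sg (insert x (insert y (insert c A)))" "sg (insert x (insert z (insert c A)))"
      using c False s unfolding PJ_singular_insert by auto
    then show ?thesis using tri[of y c] tri[of z c] A c False by auto
  qed
qed

text \<open>If \<open>S\<close> lies in all members of the clique of \<open>E\<close>, then
  \<open>S\<close> is the intersection of \<open>f (E - {x})\<close> and \<open>f (E - {z})\<close>.
  By \<open>star_Int_eq\<close> over \<open>E - {x, z}\<close>, it also lies in the member of the
  neighbouring clique in which \<open>y\<close> replaces \<open>x\<close>. Exchanges reach every
  singular \<open>(m + 2)\<close>-set, and each vertex is contained in one.\<close>

lemma star_type_big_star:
  assumes st: star_triples and l3: "m + 3 \<le> l"
    and D: "sg D" "card D = m + 2" "\<not> top_type D"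
  shows "\<exists>S\<in>G (int k - 1). \<forall>A\<in>V. S \<subseteq> f A"
proof -
  obtain S where S: "S \<in> G (int k - 1)" "\<forall>x\<in>D. S \<subseteq> f (D - {x})"
    using top_or_star[OF D(1,2)] D(3) by blast
  have all: "\<forall>x\<in>D'. S \<subseteq> f (D' - {x})" if D': "sg D'" "card D' = m + 2" for D'
  proof (rule swap_connected[where c="m+2" and A="{}" and D=D and R="\<lambda>D. \<forall>x\<in>D. S \<subseteq> f (D - {x})"])
    fix E x y assume E: "sg E" "card E = m + 2" "x \<in> E" "y \<notin> E" "sg (insert y (E - {x}))"
      "\<forall>x\<in>E. S \<subseteq> f (E - {x})"
    let ?E = "insert y (E - {x})"
    show "\<forall>z\<in>?E. S \<subseteq> f (?E - {z})"
    proof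
      fix z assume z: "z \<in> ?E"
      show "S \<subseteq> f (?E - {z})"
      proof (cases "z = y")
        case True
        then show ?thesis using E by simp
      next
        case False
        let ?A = "E - {x, z}"
        have zx: "z \<in> E" "z \<noteq> x" using z False by auto
        have c: "card ?A = m" using E zx PJ_singular_finite[OF E(1)] by (simp add: card_Diff_subset)
        have e: "insert z ?A = E - {x}" "insert x ?A = E - {z}" "insert y ?A = ?E - {z}"
          "insert z (insert x ?A) = E" "insert z (insert y ?A) = ?E" using zx E False by auto
        have a: "adj (int k) (f (E - {x})) (f (E - {z}))" using f_adj_remove E zx by blast
        have "S = f (E - {x}) \<inter> f (E - {z})"
          using in_star(2)[OF adj_G[OF a] adj_ne[OF a] S(1)] E zx a by (simp add: adj_iff)
        also have "\<dots> = f (E - {x}) \<inter> f (?E - {z})"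
          using star_Int_eq[OF st l3 c, of z x y] e E zx False by simp
        finally show ?thesis by blast
      qed
    qed
  qed (use D S D' in auto)
  have "S \<subseteq> f A" if A: "A \<in> V" for A
  proof -
    have fin: "finite A" using A PJ_singular_finite[of l A] by (simp add: V_iff)
    then obtain c where c: "1 \<le> \<bar>c\<bar>" "\<bar>c\<bar> \<le> int l" "c \<notin> A"
      "- c \<notin> A"
      using free_coordinate[of A l] A ml by (auto simp: V_iff)
    have "sg (insert c A)" "card (insert c A) = m + 2" using c A fin
      by (auto simp: PJ_singular_insert V_iff)
    then show ?thesis using all[of "insert c A"] c by auto
  qed
  then show ?thesis using S by blast
qed

lemma all_tops_if_large:
  assumes "l < 2 * m + 2"
  shows all_tops
  unfolding all_tops_def
proof (intro allI impI, rule ccontr)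
  fix D assume D: "sg D" "card D = m + 2" "\<not> top_type D"
  then obtain S where S: "S \<in> G (int k - 1)" "\<forall>x\<in>D. S \<subseteq> f (D - {x})"
    using top_or_star by blast
  let ?E = "(\<lambda>x. f (D - {x})) ` D"
  have fD: "finite D" using PJ_singular_finite D by blast
  have vG: "f (D - {x}) \<in> G (int k)" if "x \<in> D" for x
    using f_G[OF PJ_vertices_remove[OF D(1,2) that]] .
  have cl: "col p q" if "p \<in> f (D - {x})" "q \<in> f (D - {y})" "x \<in> D" "y \<in> D"
    for p q x y
  proof (cases "x = y")
    case True
    then show ?thesis using sing_col[OF G_sing[OF vG]] that by blast
  next
    case False
    then show ?thesis using f_adj_remove[OF D(1,2) that(3,4)] that
      by (auto simp: adj_iff collinear_set_def)
  qed
  have "collinear_set (\<Union>?E)" unfolding collinear_set_def using cl by blast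
  then have M: "sing (span (\<Union>?E))" by (rule sing_span)
  have sub: "H \<subseteq> span (\<Union>?E)" if "H \<in> ?E" for H using that by blast
  have ne: "D \<noteq> {}" using D by auto
  have "sdim (span (S \<union> \<Union>?E)) = int k - 1 + int (card ?E)"
  proof (rule dim_indep_star[OF S(1) M])
    show "S \<subseteq> span (\<Union>?E)" using S ne by fast
    show "gindep (int k) ?E" by (rule top_indep[OF D(1,2)])
    show "H \<in> G (int k) \<and> S \<subseteq> H \<and> H \<subseteq> span (\<Union>?E)"
      if "H \<in> ?E" for H
      using that sub vG S by auto
  qed (use fD in simp)
  moreover have "S \<union> \<Union>?E = \<Union>?E" using S ne by blast
  moreover have "inj_on (\<lambda>x. f (D - {x})) D"
    using adj_ne[OF f_adj_remove[OF D(1,2)]] by (meson inj_on_def)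
  \<comment> \<open>The \<open>m + 2\<close> independent members span dimension
    \<open>k + m + 1\<close>. With \<open>n = l + k - m\<close>, the bound \<open>n - 1\<close>
    becomes \<open>2 * m + 2 \<le> l\<close>.\<close>
  ultimately have "int k - 1 + int (m + 2) \<le> int n - 1"
    using dim_le[OF M] D(2) by (simp add: card_image)
  then show False using assms rank_eq by linarith
qed

text \<open>If the triangle over \<open>A\<close> were not a star, \<open>f (insert z A)\<close>
  would lie in the join of the other two, which is the subspace \<open>W\<close> belonging to
  \<open>D = insert x (insert y A)\<close>. For \<open>w\<close> in \<open>A\<close>, also
  \<open>f (D - {w})\<close> lies in \<open>W\<close>, and two members inside \<open>W\<close> are
  adjacent; but their labels share only the \<open>m - 1\<close> elements of
  \<open>A - {w}\<close>.\<close>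

lemma star_triples_if_all_tops:
  assumes t: all_tops
  shows star_triples
  unfolding star_triples_def
proof (intro allI impI, rule ccontr)
  fix A x y z
  assume s: "sg (insert x (insert y (insert z A)))"
    and A: "card A = m" "x \<notin> A" "y \<notin> A" "z \<notin> A" "distinct [x, y, z]"
    and n: "\<not> triple_star (int k) (f (insert x A)) (f (insert y A)) (f (insert z A))"
  have s2: "sg (insert x (insert y A))" "sg (insert x (insert z A))" "sg (insert y (insert z A))"
    using s by (simp_all add: PJ_singular_insert)
  have fA: "finite A" using PJ_singular_finite[OF s] by simp
  obtain w where w: "w \<in> A" using A m0 by fastforce
  let ?a = "f (insert x A)" and ?b = "f (insert y A)" and ?c = "f (insert z A)"
  have a: "adj (int k) ?a ?b" "adj (int k) ?a ?c" "adj (int k) ?b ?c" using f_adj_insert A s2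
    by auto
  then have T: "triple_top (int k) ?a ?b ?c" using triple_top_or_triple_star n by blast
  let ?D = "insert x (insert y A)"
  have "top_type ?D" using t s2 A fA unfolding all_tops_def by simp
  then obtain W where W: "W \<in> G (int k + 1)" "\<forall>v\<in>?D. f (?D - {v}) \<subseteq> W"
    unfolding top_type_def by blast
  have "?D - {x} = insert y A" "?D - {y} = insert x A" using A by auto
  then have "?a \<subseteq> W" "?b \<subseteq> W" using W by auto
  then have "W = join ?a ?b" using in_join(2)[OF adj_G[OF a(1)] adj_ne[OF a(1)] W(1)] by blast
  then have c: "?c \<subseteq> W" using triple_top_join[OF a(1) T] by blast
  have d: "f (?D - {w}) \<subseteq> W" using W w by blast
  have v: "?D - {w} \<in> V" "insert z A \<in> V"
    using PJ_vertices_remove[OF s2(1)] A(1-3,5) fA w V_insert[of z A] A(4) s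
    by (auto simp: PJ_singular_insert)
  have "f (?D - {w}) \<noteq> f (insert z A)" using w f_eq[OF v] by blast
  then have "adj (int k) (f (?D - {w})) (f (insert z A))"
    by (rule in_join(1)[OF f_G[OF v(1)] f_G[OF v(2)] _ W(1) d c])
  then have "PJ_adj l m (?D - {w}) (insert z A)" using f_adj v by blast
  then have "card ((?D - {w}) \<inter> insert z A) = m" by (simp add: PJ_adj_def)
  moreover have "(?D - {w}) \<inter> insert z A = A - {w}" using A by auto
  ultimately show False using w fA A m0 by simp
qed

text \<open>A top triangle with \<open>x\<close>, \<open>y\<close>, \<open>z\<close> remains one
  when \<open>z\<close> is replaced by a free coordinate \<open>c\<close>, and again when
  \<open>c\<close> is replaced by \<open>- z\<close>. Then \<open>f (insert z A)\<close> and
  \<open>f (insert (- z) A)\<close> lie in the same join and are adjacent, which their labels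
  forbid. The coordinate \<open>c\<close> requires \<open>m + 4 \<le> l\<close>.\<close>

lemma star_triples_if_rank_gt:
  assumes "m + 4 \<le> l"
  shows star_triples
  unfolding star_triples_def
proof (intro allI impI, rule ccontr)
  fix A x y z
  assume s: "sg (insert x (insert y (insert z A)))"
    and A: "card A = m" "x \<notin> A" "y \<notin> A" "z \<notin> A" "distinct [x, y, z]"
    and n: "\<not> triple_star (int k) (f (insert x A)) (f (insert y A)) (f (insert z A))"
  have l3: "m + 3 \<le> l" using assms by simp
  have fA: "finite A" using PJ_singular_finite[OF s] by simp
  let ?F = "\<lambda>v. f (insert v A)"
  have adjF: "adj (int k) (?F u) (?F v)"
    if "sg (insert u (insert v A))" "u \<notin> A" "v \<notin> A" "u \<noteq> v" for u v
    using f_adj_insert A that by blast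
  have "card (insert x (insert y (insert z A))) < l" using A fA assms by simp
  then obtain c where c: "1 \<le> \<bar>c\<bar>" "\<bar>c\<bar> \<le> int l"
    "c \<notin> insert x (insert y (insert z A))" "- c \<notin> insert x (insert y (insert z A))"
    using free_coordinate[of "insert x (insert y (insert z A))" l] fA by blast
  have z: "1 \<le> \<bar>z\<bar>" "\<bar>- z\<bar> \<le> int l" "- z \<notin> A" "- z \<noteq> z"
    "- z \<noteq> x" "- z \<noteq> y" "- z \<noteq> c"
    using s c unfolding PJ_singular_insert by auto
  have sc: "sg (insert c (insert x (insert y (insert z A))))"
    using s c unfolding PJ_singular_insert by auto
  have sz: "sg (insert (- z) (insert c (insert x (insert y A))))"
    using sc c A unfolding PJ_singular_insert by auto
  have T: "triple_top (int k) (?F x) (?F y) (?F z)"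
    using triple_top_or_triple_star[OF adjF adjF adjF] n A s by (auto simp: PJ_singular_insert)
  have T2: "triple_top (int k) (?F x) (?F y) (?F c)"
    by (rule triple_top_extend[OF _ _ _ _ _ _ T n]; rule adjF)
      (use A c sc in \<open>auto simp: PJ_singular_insert\<close>)
  have nc: "\<not> triple_star (int k) (?F x) (?F y) (?F c)"
    by (rule independent_star_triple[OF l3 _ A(1) _ _ _ _ T2]) (use A c sc in \<open>auto simp: PJ_singular_insert\<close>)
  have T3: "triple_top (int k) (?F x) (?F y) (?F (- z))"
    by (rule triple_top_extend[OF _ _ _ _ _ _ T2 nc]; rule adjF)
      (use A c z sz in \<open>auto simp: PJ_singular_insert\<close>)
  have v: "insert z A \<in> V" "insert (- z) A \<in> V"
    using V_insert A z sz s by (auto simp: PJ_singular_insert)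
  have a: "adj (int k) (?F x) (?F y)"
    by (rule adjF) (use A s in \<open>auto simp: PJ_singular_insert\<close>)
  show False
    using triple_top_adj[OF a T T3 f_G[OF v(1)] f_G[OF v(2)]] f_nonadj[OF v, of z] by blast
qed

end

section \<open>The exceptional automorphisms of \<open>PJ(4,1)\<close>\<close>

lemma maximal_clique_image:
  assumes g: "bij_betw g V W" and E: "\<And>x y. x \<in> V \<Longrightarrow>
    y \<in> V \<Longrightarrow> E x y \<longleftrightarrow> F (g x) (g y)"
    and C: "maximal_clique V E C"
  shows "maximal_clique W F (g ` C)"
proof -
  have CV: "C \<subseteq> V" and cC: "graph_clique V E C" using C
    by (auto simp: maximal_clique_def graph_clique_def)
  have gV: "g ` V = W" and inj: "inj_on g V" using g by (auto simp: bij_betw_def)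
  have "graph_clique W F (g ` C)"
    unfolding graph_clique_def using CV gV E graph_cliqueD[OF cC] by blast
  moreover have "D = g ` C" if D: "graph_clique W F D" "g ` C \<subseteq> D" for D
  proof -
    let ?C = "{x \<in> V. g x \<in> D}"
    have "graph_clique V E ?C"
      unfolding graph_clique_def
    proof (intro conjI ballI impI)
      fix x y assume xy: "x \<in> ?C" "y \<in> ?C" "x \<noteq> y"
      then have "g x \<noteq> g y" using inj by (auto simp: inj_on_def)
      then show "E x y" using graph_cliqueD[OF D(1)] xy E by simp
    qed auto
    moreover have "C \<subseteq> ?C" using CV D by auto
    ultimately have "?C = C" using C unfolding maximal_clique_def by blast
    moreover have "D \<subseteq> g ` ?C" using D(1) gV by (auto simp: graph_clique_def)
    ultimately show ?thesis using D(2) by auto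
  qed
  ultimately show ?thesis unfolding maximal_clique_def by blast
qed

text \<open>
  The pairs \<open>{i, j}\<close> are the roots \<open>\<plusminus>e\<^sub>i \<plusminus> e\<^sub>j\<close> of \<open>D\<^sub>4\<close>, that is, the vertices of the 24-cell. For a
  maximal singular set \<open>M\<close>, the map below is the negative of the reflection in the vector
  \<open>\<Sum>i\<in>M. e\<^sub>i\<close>, where \<open>e\<^sub>-\<^sub>i = - e\<^sub>i\<close>. It exchanges the octahedral cells consisting of the pairs that
  contain a fixed element with one of the two classes of cells consisting of the pairs inside a
  maximal singular set.
\<close>

definition triality :: "int set \<Rightarrow> int set \<Rightarrow> int set" where
  "triality M A = (if A \<subseteq> M then M - A else if A \<subseteq> uminus ` M then uminus ` M - A else uminus ` A)"

lemma triality_eqs: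
  assumes "distinct [a, b, c, d, - a, - b, - c, - d]"
  shows "triality {a, b, c, d} {a, b} = {c, d}" "triality {a, b, c, d} {- a, - b} = {- c, - d}"
    "triality {a, b, c, d} {a, - b} = {- a, b}"
  using assms unfolding triality_def by auto

text \<open>These are all sign patterns of the pairs formed by \<open>a\<close> with
  \<open>b\<close> or \<open>c\<close>, that is, of two adjacent vertices whose common element is
  \<open>a\<close> or \<open>- a\<close>.\<close>

lemma triality_eqs_four:
  assumes "distinct [a, b, c, d, - a, - b, - c, - d]" "M = {a, b, c, d}"
  shows "triality M {a, b} = {c, d}" "triality M {a, c} = {b, d}"
    "triality M {- a, - b} = {- c, - d}" "triality M {- a, - c} = {- b, - d}"
    "triality M {a, - b} = {- a, b}" "triality M {a, - c} = {- a, c}"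
      "triality M {- a, b} = {a, - b}" "triality M {- a, c} = {a, - c}"
proof -
  have e: "M = {a, c, b, d}" "M = {b, a, c, d}" "M = {c, a, b, d}" using assms by auto
  have d: "distinct [a, c, b, d, - a, - c, - b, - d]" "distinct [b, a, c, d, - b, - a, - c, - d]"
    "distinct [c, a, b, d, - c, - a, - b, - d]" using assms(1) by auto
  show "triality M {a, b} = {c, d}" "triality M {- a, - b} = {- c, - d}"
    "triality M {a, - b} = {- a, b}"
    using triality_eqs[OF assms(1)] assms(2) by auto
  show "triality M {a, c} = {b, d}" "triality M {- a, - c} = {- b, - d}"
    "triality M {a, - c} = {- a, c}"
    using triality_eqs[OF d(1)] e by auto
  show "triality M {- a, b} = {a, - b}" using triality_eqs(3)[OF d(2)] e
    by (auto simp: insert_commute)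
  show "triality M {- a, c} = {a, - c}" using triality_eqs(3)[OF d(3)] e
    by (auto simp: insert_commute)
qed

lemma PJ_singular_pairwise:
  "PJ_singular l {x, y, z} \<longleftrightarrow>
    (\<forall>j\<in>{x, y, z}. 1 \<le> \<bar>j\<bar> \<and> \<bar>j\<bar> \<le> int l) \<and> x \<noteq> - y \<and> x \<noteq> - z \<and> y \<noteq> - z"
  by (auto simp: PJ_singular_def)

lemma PJ_adj_pair:
  assumes "3 \<le> l"
  shows "PJ_adj l 1 A B \<longleftrightarrow> (\<exists>p q r. A = {p, q} \<and> B = {p, r} \<and>
    distinct [p, q, r] \<and> PJ_singular l {p, q, r})"
proof
  assume "PJ_adj l 1 A B"
  then have s: "PJ_singular l (A \<union> B)" "card A = 2" "card B = 2" "card (A \<inter> B) = 1"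
    using PJ_adj_iff[of 1 l A B] assms by auto
  then obtain p where p: "A \<inter> B = {p}" by (meson card_1_singletonE)
  have pair: "\<exists>q. C = {p, q} \<and> p \<noteq> q" if "card C = 2" "p \<in> C"
    for C :: "int set"
    using that by (auto simp: card_2_iff)
  have "p \<in> A" "p \<in> B" using p by auto
  then obtain q r where qr: "A = {p, q}" "p \<noteq> q" "B = {p, r}" "p \<noteq> r"
    using pair s(2,3) by meson
  then have "q \<noteq> r" using p by auto
  moreover have "A \<union> B = {p, q, r}" using qr by auto
  ultimately show "\<exists>p q r. A = {p, q} \<and> B = {p, r} \<and> distinct [p, q, r] \<and>
    PJ_singular l {p, q, r}"
    using s(1) qr by auto
next
  assume "\<exists>p q r. A = {p, q} \<and> B = {p, r} \<and> distinct [p, q, r] \<and>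
    PJ_singular l {p, q, r}"
  then obtain p q r where a: "A = {p, q}" "B = {p, r}" "distinct [p, q, r]"
    "PJ_singular l {p, q, r}" by blast
  then have "A \<union> B = {p, q, r}" "A \<inter> B = {p}" by auto
  then show "PJ_adj l 1 A B" using a PJ_adj_iff[of 1 l A B] assms by auto
qed

lemma PJ_singular_neg: "PJ_singular l A \<Longrightarrow> x \<in> A \<Longrightarrow>
  y \<in> A \<Longrightarrow> x \<noteq> - y"
  by (auto simp: PJ_singular_def)

lemma PJ_adj_pairI: "3 \<le> l \<Longrightarrow> PJ_singular l {p, q, r} \<Longrightarrow>
  distinct [p, q, r] \<Longrightarrow> PJ_adj l 1 {p, q} {p, r}"
  by (subst PJ_adj_pair) auto

lemma maximal_singular_four:
  assumes "PJ_singular 4 M" "card M = 4" "p \<in> M" "q \<in> M" "r \<in> M" "distinct [p, q, r]"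
  shows "\<exists>s. M = {p, q, r, s} \<and> distinct [p, q, r, s, - p, - q, - r, - s]"
proof -
  have "card (M - {p, q, r}) = 1" using assms PJ_singular_finite[OF assms(1)]
    by (simp add: card_Diff_subset)
  then obtain s where "M - {p, q, r} = {s}" by (meson card_1_singletonE)
  then have s: "M = {p, q, r, s}" "s \<notin> {p, q, r}" using assms by auto
  have "PJ_singular 4 {p, q, r, s}" using assms(1) s by simp
  then have "\<forall>x\<in>{p, q, r, s}. \<forall>y\<in>{p, q, r, s}. x \<noteq> - y"
    using PJ_singular_neg by blast
  then have "distinct [p, q, r, s, - p, - q, - r, - s]" using s(2) assms(6) by auto
  then show ?thesis using s by blast
qed

lemma triality_adj:
  assumes M: "PJ_singular 4 M" "card M = 4" and a: "PJ_adj 4 1 A B"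
  shows "PJ_adj 4 1 (triality M A) (triality M B)"
proof -
  obtain p q r where pqr: "A = {p, q}" "B = {p, r}" "distinct [p, q, r]" "PJ_singular 4 {p, q, r}"
    using a PJ_adj_pair[of 4] by auto
  \<comment> \<open>Exactly the representative of \<open>x\<close> up to sign that belongs to
    \<open>M\<close>; it reduces arbitrary adjacent pairs to sign patterns over a fixed basis
    \<open>x\<close>, \<open>y\<close>, \<open>z\<close>, \<open>s\<close>.\<close>
  define sn where "sn = (\<lambda>x. if x \<in> M then x else - x)"
  have in_M: "x \<in> M \<or> - x \<in> M" if "x \<in> {p, q, r}" for x
    using PJ_singular_total[OF M] pqr(4) that unfolding PJ_singular_pairwise by auto
  have "sn p \<in> M" "sn q \<in> M" "sn r \<in> M" using in_M by (auto simp: sn_def)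
  moreover have "distinct [sn p, sn q, sn r]"
    using pqr unfolding PJ_singular_pairwise sn_def by auto
  ultimately obtain s where s: "M = {sn p, sn q, sn r, s}"
      "distinct [sn p, sn q, sn r, s, - sn p, - sn q, - sn r, - s]"
    using maximal_singular_four[OF M] by blast
  have signs: "p = sn p \<or> p = - sn p" "q = sn q \<or> q = - sn q" "r = sn r \<or> r = - sn r"
    by (auto simp: sn_def)
  obtain x y z where xyz: "x = sn p" "y = sn q" "z = sn r" by blast
  have ms: "M = {x, y, z, s}" and di: "distinct [x, y, z, s, - x, - y, - z, - s]" using s xyz
    by auto
  note t = triality_eqs_four[OF di ms]
  have bd: "\<forall>j\<in>{x, y, z, s, - x, - y, - z, - s}. 1 \<le> \<bar>j\<bar> \<and>
    \<bar>j\<bar> \<le> int 4" using M(1) ms by (auto simp: PJ_singular_def)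
  have I: "PJ_adj 4 1 {u, v} {u, w}"
    if "{u, v, w} \<subseteq> {x, y, z, s, - x, - y, - z, - s}" "distinct [u, v, w, - u, - v, - w]"
      for u v w
  proof -
    have "\<forall>j\<in>{u, v, w}. 1 \<le> \<bar>j\<bar> \<and> \<bar>j\<bar> \<le> int 4"
      using that(1) bd by blast
    moreover have "u \<noteq> - v \<and> u \<noteq> - w \<and> v \<noteq> - w" using that(2) by simp
    ultimately have "PJ_singular 4 {u, v, w}" unfolding PJ_singular_pairwise by blast
    moreover have "distinct [u, v, w]" using that(2) by simp
    ultimately show ?thesis by (intro PJ_adj_pairI) auto
  qed
  have "p = x \<or> p = - x" "q = y \<or> q = - y" "r = z \<or> r = - z" using signs xyz by auto
  \<comment> \<open>One pair of images for each of the eight choices of signs of \<open>p\<close>,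
    \<open>q\<close>, \<open>r\<close>, with the common element written first as \<open>I\<close>
    requires.\<close>
  moreover have "PJ_adj 4 1 {s, z} {s, y}" "PJ_adj 4 1 {- s, - z} {- s, - y}"
    "PJ_adj 4 1 {z, s} {z, - x}" "PJ_adj 4 1 {y, - x} {y, s}" "PJ_adj 4 1 {- x, y} {- x, z}"
    "PJ_adj 4 1 {x, - y} {x, - z}" "PJ_adj 4 1 {- y, x} {- y, - s}" "PJ_adj 4 1 {- z, - s} {- z, x}"
    by (rule I; use di in auto)+
  then have "PJ_adj 4 1 {z, s} {y, s}" "PJ_adj 4 1 {- z, - s} {- y, - s}"
    "PJ_adj 4 1 {z, s} {- x, z}" "PJ_adj 4 1 {- x, y} {y, s}" "PJ_adj 4 1 {- x, y} {- x, z}"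
    "PJ_adj 4 1 {x, - y} {x, - z}" "PJ_adj 4 1 {x, - y} {- y, - s}" "PJ_adj 4 1 {- z, - s} {x, - z}"
    by (simp_all only: insert_commute)
  ultimately show ?thesis using pqr(1,2) t by (elim disjE) simp_all
qed

text \<open>Adjacency includes being a vertex, so a neighbour lets preservation of adjacency yield
  preservation of vertices.\<close>

lemma pair_in_adj:
  assumes "A \<in> PJ_vertices 4 1"
  shows "\<exists>B. PJ_adj 4 1 A B"
proof -
  have A: "PJ_singular 4 A" "card A = 2" using assms by (auto simp: PJ_vertices_def)
  then obtain p q where pq: "A = {p, q}" "p \<noteq> q" by (auto simp: card_2_iff)
  obtain c where c: "1 \<le> \<bar>c\<bar>" "\<bar>c\<bar> \<le> int 4" "c \<notin> A"
    "- c \<notin> A"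
    using free_coordinate[of A 4] A PJ_singular_finite by auto
  have "PJ_singular 4 {c, p, q}" using A(1) c pq by (auto simp: PJ_singular_insert)
  then have "PJ_adj 4 1 {p, q} {p, c}"
    using c pq by (intro PJ_adj_pairI) (auto simp: insert_commute)
  then show ?thesis using pq by blast
qed

lemma triality_involution:
  assumes M: "PJ_singular 4 M" "card M = 4" and A: "A \<in> PJ_vertices 4 1"
  shows "triality M (triality M A) = A"
proof -
  have A: "PJ_singular 4 A" "card A = 2" using assms by (auto simp: PJ_vertices_def)
    have fM: "finite M" using PJ_singular_finite M by blast
  show ?thesis
  proof (cases "A \<subseteq> M")
    case True
    then have "card (M - A) = 2" using A M fM finite_subset[OF True fM]
      by (simp add: card_Diff_subset)
    then show ?thesis using True by (auto simp: triality_def)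
  next
    case False
    show ?thesis
    proof (cases "A \<subseteq> uminus ` M")
      case True
      have "card (uminus ` M - A) = 2"
        using A M fM True finite_subset[OF True] by (simp add: card_Diff_subset card_image)
      then have "uminus ` M - A \<noteq> {}" by (metis card.empty zero_neq_numeral)
      moreover have "M \<inter> uminus ` M = {}" using M(1) by (auto simp: PJ_singular_def)
      ultimately have "\<not> uminus ` M - A \<subseteq> M" by blast
      then show ?thesis using True False by (auto simp: triality_def)
    next
      case F2: False
      have 1: "\<not> uminus ` A \<subseteq> M"
      proof
        assume "uminus ` A \<subseteq> M"
        then have "uminus ` uminus ` A \<subseteq> uminus ` M" by (rule image_mono)
        then show False using F2 by (simp add: image_image)
      qed
      have 2: "\<not> uminus ` A \<subseteq> uminus ` M" using False
        by (metis inj_image_subset_iff inj_uminus)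
      show ?thesis using F2 False 1 2 by (simp add: triality_def image_image)
    qed
  qed
qed

lemma triality_vertex:
  assumes M: "PJ_singular 4 M" "card M = 4" and A: "A \<in> PJ_vertices 4 1"
  shows "triality M A \<in> PJ_vertices 4 1"
  using pair_in_adj[OF A] triality_adj[OF M] by (auto simp: PJ_adj_def)

lemma triality_adj_iff:
  assumes M: "PJ_singular 4 M" "card M = 4"
    and A: "A \<in> PJ_vertices 4 1" "B \<in> PJ_vertices 4 1"
  shows "PJ_adj 4 1 (triality M A) (triality M B) \<longleftrightarrow> PJ_adj 4 1 A B"
  using triality_adj[OF M, of A B] triality_adj[OF M, of "triality M A" "triality M B"]
    triality_involution[OF M] A by auto

lemma triality_bij:
  assumes M: "PJ_singular 4 M" "card M = 4"
  shows "bij_betw (triality M) (PJ_vertices 4 1) (PJ_vertices 4 1)"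
  by (rule bij_betw_byWitness[where f'="triality M"]) (use triality_involution[OF M] triality_vertex[OF M] in auto)

context PJ_embedding
begin

section \<open>The exceptional case, and the choice of a labelling\<close>

lemma f_adj_pair:
  assumes "m = 1" "PJ_singular l {x, y, z}" "distinct [x, y, z]"
  shows "adj (int k) (f {x, y}) (f {x, z})"
proof -
  have "PJ_adj l m {x, y} {x, z}" using assms PJ_adj_pair[of l] ml by auto
  then show ?thesis using f_adj by (simp add: PJ_adj_def)
qed

lemma top_type_triple:
  assumes "distinct [a, b, c]"
  shows "top_type {a, b, c} \<longleftrightarrow>
    triple_top (int k) (f {a, b}) (f {a, c}) (f {b, c})"
proof -
  have "{a, b, c} - {a} = {b, c}" "{a, b, c} - {b} = {a, c}" "{a, b, c} - {c} = {a, b}" using assms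
    by auto
  then show ?thesis unfolding top_type_def triple_top_def by auto
qed

text \<open>The six pairs inside \<open>{a, b, c, d}\<close> are the vertices of an octahedron in
  which disjoint pairs are opposite. The faces belonging to \<open>{a, b, c}\<close> and
  \<open>{a, b, d}\<close> share only the vertex \<open>{a, b}\<close>, so \<open>octahedron\<close>
  transfers the type.\<close>

lemma top_type_step:
  assumes m: "m = 1" and s: "sg {a, b, c, d}" and di: "distinct [a, b, c, d]"
    and t: "top_type {a, b, c}"
  shows "top_type {a, b, d}"
proof -
  have sp: "sg {x, y, z}" if "{x, y, z} \<subseteq> {a, b, c, d}" for x y z
    using PJ_singular_subset[OF s that] .
  have ad: "adj (int k) (f {x, y}) (f {x, z})"
    if "{x, y, z} \<subseteq> {a, b, c, d}" "distinct [x, y, z]" for x y z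
    using f_adj_pair[OF m sp[OF that(1)] that(2)] .
  have V2: "{x, y} \<in> V" if "{x, y} \<subseteq> {a, b, c, d}" "x \<noteq> y" for x y
    using PJ_singular_subset[OF s that(1)] that(2) m by (simp add: PJ_vertices_def)
  have na: "\<not> adj (int k) (f A) (f B)" "f A \<noteq> f B"
    if "A \<in> V" "B \<in> V" "A \<inter> B = {}" for A B
  proof -
    show "\<not> adj (int k) (f A) (f B)" using f_adj that m by (simp add: PJ_adj_def)
    have "A \<noteq> {}" using that by (auto simp: V_iff)
    then show "f A \<noteq> f B" using f_eq that by blast
  qed
  have T: "triple_top (int k) (f {a, b}) (f {a, c}) (f {b, c})" using t top_type_triple di by simp
  have e: "{a, b, c} - {a} = {b, c}" "{a, b, c} - {b} = {a, c}" "{a, b, c} - {c} = {a, b}" using di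
    by auto
  have nst: "\<not> triple_star (int k) (f {a, b}) (f {a, c}) (f {b, c})"
    using independent_top_triple[of "{a, b, c}" c b a] T sp[of a b c] di m unfolding e by auto
  have "triple_top (int k) (f {a, b}) (f {b, d}) (f {a, d})"
  proof (rule octahedron[OF _ _ _ _ _ _ _ _ _ _ _ _ T nst])
    show "adj (int k) (f {a, b}) (f {a, c})" using ad[of a b c] di by auto
    show "adj (int k) (f {a, b}) (f {b, c})" using ad[of b a c] di by (auto simp: insert_commute)
    show "adj (int k) (f {a, c}) (f {b, c})" using ad[of c a b] di by (auto simp: insert_commute)
    show "adj (int k) (f {a, b}) (f {b, d})" using ad[of b a d] di by (auto simp: insert_commute)
    show "adj (int k) (f {a, b}) (f {a, d})" using ad[of a b d] di by auto
    show "adj (int k) (f {a, c}) (f {a, d})" using ad[of a c d] di by auto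
    show "adj (int k) (f {b, d}) (f {b, c})" using ad[of b d c] di by auto
    show "adj (int k) (f {b, d}) (f {a, d})" using ad[of d b a] di by (auto simp: insert_commute)
    show "f {a, c} \<noteq> f {b, d}" "\<not> adj (int k) (f {a, c}) (f {b, d})" 
      using na[OF V2 V2, of a c b d] di by auto
    show "f {b, c} \<noteq> f {a, d}" "\<not> adj (int k) (f {b, c}) (f {a, d})" 
      using na[OF V2 V2, of b c a d] di by auto
  qed
  then have "triple_top (int k) (f {a, b}) (f {a, d}) (f {b, d})" by (rule triple_top_perm)
  then show ?thesis using top_type_triple[of a b d] di by simp
qed

text \<open>Each exchange of one element is a case of \<open>top_type_step\<close>, except when an
  element is replaced by its negative; this is done in two steps through a fourth coordinate
  \<open>d\<close>.\<close>

lemma top_type_propagates: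
  assumes m: "m = 1" and l: "l = 4" and D: "sg D" "card D = 3" "top_type D"
  shows all_tops
  unfolding all_tops_def
proof (intro allI impI)
  fix D' assume D': "sg D'" "card D' = m + 2"
  show "top_type D'"
  proof (rule swap_connected[where c=3 and A="{}" and D=D and R=top_type])
    fix E x y assume E: "sg E" "card E = 3" "x \<in> E" "y \<notin> E" "sg (insert y (E - {x}))"
      "top_type E"
    have "card (E - {x}) = 2" using E PJ_singular_finite by simp
    then obtain a b where ab: "E - {x} = {a, b}" "a \<noteq> b" by (auto simp: card_2_iff)
    then have Ee: "E = {a, b, x}" "x \<noteq> a" "x \<noteq> b" "y \<noteq> a" "y \<noteq> b"
      "y \<noteq> x" using E by auto
    have step: "top_type {a, b, v}" if "sg {a, b, u}" "sg {a, b, v}" "u \<noteq> v" "u \<noteq> - v"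
      "top_type {a, b, u}" "u \<notin> {a, b}" "v \<notin> {a, b}" for u v
    proof (rule top_type_step[OF m _ _ that(5)])
      show "sg {a, b, u, v}" using that(1,2,4) unfolding PJ_singular_insert by auto
    qed (use that ab in auto)
    have sx: "sg {a, b, x}" and sy: "sg {a, b, y}"
      using E ab Ee by (simp_all add: insert_commute)
    have "top_type {a, b, y}"
    proof (cases "x = - y")
      case False
      then show ?thesis using step[of x y] sx sy E Ee by auto
    next
      case True
      obtain d where d: "1 \<le> \<bar>d\<bar>" "\<bar>d\<bar> \<le> int l" "d \<notin> E"
        "- d \<notin> E"
        using free_coordinate[of E l] E l PJ_singular_finite by auto
      have sd: "sg {a, b, d}" using sx d Ee unfolding PJ_singular_insert by auto
      have "top_type {a, b, d}" using step[of x d] sx sd d Ee E by auto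
      then show ?thesis using step[of d y] sy sd d Ee True by auto
    qed
    then show "top_type (insert y (E - {x}))" using ab by (simp add: insert_commute)
  qed (use D D' m in auto)
qed

lemma embedding_triality:
  assumes m: "m = 1" and l: "l = 4" and M: "sg M" "card M = 4"
  shows "PJ_embedding P L n k l m (f \<circ> triality M)" "(f \<circ> triality M) ` V = f ` V"
proof -
  have M4: "PJ_singular 4 M" using M l by simp
  note bij = triality_bij[OF M4 M(2)] and adjM = triality_adj_iff[OF M4 M(2)]
  have V4: "V = PJ_vertices 4 1" using m l by simp
  show "(f \<circ> triality M) ` V = f ` V" using bij V4
    by (simp add: bij_betw_def flip: image_image)
  show "PJ_embedding P L n k l m (f \<circ> triality M)"
  proof unfold_locales
    show "(f \<circ> triality M) A \<in> G (int k)" if "A \<in> V" for A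
      using f_G triality_vertex[OF M4 M(2)] that V4 by simp
    show "inj_on (f \<circ> triality M) V"
      using f_inj bij V4 by (simp add: comp_inj_on bij_betw_def)
    show "adj (int k) ((f \<circ> triality M) A) ((f \<circ> triality M) B) \<longleftrightarrow>
      PJ_adj l m A B" if "A \<in> V" "B \<in> V" for A B
      using f_adj[of "triality M A" "triality M B"] triality_vertex[OF M4 M(2)] adjM that V4 m l
        by simp
    show "gindep (int k) ((f \<circ> triality M) ` C)" if "maximal_clique V (PJ_adj l m) C" for C
    proof -
      have "maximal_clique V (PJ_adj l m) (triality M ` C)"
        by (rule maximal_clique_image[OF _ _ that]) (use bij adjM m l in auto)
      then show ?thesis using f_indep[of "triality M ` C"] by (simp only: image_comp)
    qed
  qed (rule m0 ml rank_eq)+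
qed

text \<open>\<open>f\<close> itself serves unless some triangle over an \<open>m\<close>-set is not
  a star while \<open>2 * m + 2 \<le> l\<close>. Then \<open>m = 1\<close> and \<open>l = 4\<close>,
  and one triality map makes a single top clique, from which the type spreads to all others.\<close>

lemma good_embedding:
  assumes h: "l < 2 * m + 2 \<or> \<not> (\<exists>S\<in>G (int k - 1). \<forall>A\<in>V. S \<subseteq> f A)"
  shows "\<exists>f'. PJ_embedding P L n k l m f' \<and> f' ` V = f ` V \<and>
    (\<forall>D. sg D \<longrightarrow> card D = m + 2 \<longrightarrow> (\<exists>W\<in>G (int k + 1). \<forall>x\<in>D. f' (D - {x}) \<subseteq> W))"
proof -
  have *: ?thesis if all_tops
    using that PJ_embedding_axioms unfolding all_tops_def top_type_def by blast
  show ?thesis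
  proof (cases "l < 2 * m + 2")
    case True
    then show ?thesis using * all_tops_if_large by blast
  next
    case False
    then have l3: "m + 3 \<le> l" using m0 by linarith
    show ?thesis
    proof (cases star_triples)
      case True
      then have all_tops using star_type_big_star[OF True l3] h False unfolding all_tops_def
        by blast
      then show ?thesis by (rule *)
    next
      case ns: False
      then have "\<not> m + 4 \<le> l" using star_triples_if_rank_gt by blast
      then have ml1: "m = 1" "l = 4" using False m0 by linarith+
      obtain A x y z where s: "sg (insert x (insert y (insert z A)))"
        and A: "card A = m" "x \<notin> A" "y \<notin> A" "z \<notin> A" "distinct [x, y, z]"
        and n: "\<not> triple_star (int k) (f (insert x A)) (f (insert y A)) (f (insert z A))"
        using ns unfolding star_triples_def by blast
      obtain w where w: "A = {w}" using A ml1 by (meson card_1_singletonE)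
      \<comment> \<open>Complements in this set exchange the pairs through \<open>w\<close> with the
        pairs inside \<open>{x, y, z}\<close>, so the top triangle over \<open>A = {w}\<close>
        becomes the clique of a singular triple.\<close>
      let ?M = "{x, y, z, w}"
      have M: "sg ?M" "card ?M = 4" using s A w by auto
      have "adj (int k) (f (insert x A)) (f (insert y A))"
        "adj (int k) (f (insert x A)) (f (insert z A))"
          "adj (int k) (f (insert y A)) (f (insert z A))"
        using s A by (auto intro!: f_adj_insert simp: PJ_singular_insert)
      then have T: "triple_top (int k) (f {x, w}) (f {y, w}) (f {z, w})"
        using triple_top_or_triple_star n w by blast
      have di: "distinct [x, y, z, w]" using A w by auto
      interpret T: PJ_embedding P L n k l m "f \<circ> triality ?M"
        using embedding_triality[OF ml1 M] by blast
      have t: "triality ?M {x, y} = {z, w}" "triality ?M {x, z} = {y, w}"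
        "triality ?M {y, z} = {x, w}"
        using di unfolding triality_def by auto
      have "triple_top (int k) ((f \<circ> triality ?M) {x, y}) ((f \<circ> triality ?M) {x, z}) ((f \<circ> triality ?M) {y, z})"
        using T triple_top_perm unfolding comp_def t by blast
      then have "T.top_type {x, y, z}" using T.top_type_triple[of x y z] di by simp
      then have T.all_tops
        using T.top_type_propagates[OF ml1, of "{x, y, z}"]
          PJ_singular_subset[OF M(1), of "{x, y, z}"] di by auto
      then show ?thesis using embedding_triality[OF ml1 M]
        unfolding T.all_tops_def T.top_type_def by blast
    qed
  qed
qed

end

section \<open>Reconstruction of the apartment\<close>

lemma PJ_singular_extend_to:
  assumes "PJ_singular l A" "card A \<le> c" "c \<le> l"
  shows "\<exists>D. A \<subseteq> D \<and> PJ_singular l D \<and> card D = c"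
proof -
  obtain M where M: "A \<subseteq> M" "PJ_singular l M" "card M = l"
    using PJ_singular_extend[OF assms(1)] by blast
  obtain D where "A \<subseteq> D" "D \<subseteq> M" "card D = c"
    using exists_subset_between[of A c M] assms M PJ_singular_finite by auto
  then show ?thesis using PJ_singular_subset M by blast
qed

text \<open>Here \<open>f\<close> is the labelling after a possible composition with triality. An
  apartment depends only on the image, so the change does no harm.\<close>

locale PJ_top_embedding = PJ_embedding P L n k l m f
  for P :: "'a set" and L :: "'a set set" and n k l m :: nat
    and f :: "int set \<Rightarrow> 'a set" +
  assumes tops: "PJ_singular l D \<Longrightarrow> card D = m + 2 \<Longrightarrow>
    \<exists>W\<in>polar_grass P L (int k + 1). \<forall>x\<in>D. f (D - {x}) \<subseteq> W"
begin

lemma star_triples: star_triples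
  by (rule star_triples_if_all_tops) (simp add: all_tops_def top_type_def tops)

text \<open>For \<open>l = m + 2\<close> no further coordinate is available, and \<open>z\<close> is
  \<open>y\<close> or \<open>- y\<close>. In the second case the vertices \<open>insert v A\<close>
  with \<open>v = x, y, - x, - y\<close> form a four-cycle without diagonals, and
  \<open>k = n - 2\<close>, as \<open>four_cycle\<close> demands.\<close>

lemma star_Int:
  assumes A: "card A = m" "x \<notin> A" "y \<notin> A" "z \<notin> A" "x \<noteq> y" "x \<noteq> z"
    and s: "sg (insert x (insert y A))" "sg (insert x (insert z A))"
  shows "f (insert x A) \<inter> f (insert y A) = f (insert x A) \<inter> f (insert z A)"
proof (cases "m + 3 \<le> l")
  case True
  then show ?thesis using star_Int_eq[OF star_triples] assms by blast
next
  case False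
  then have l: "l = m + 2" using ml by simp
  have fin: "finite A" using PJ_singular_finite[OF s(1)] by simp
  have c: "card (insert x (insert y A)) = l" using A fin l by simp
  have zz: "1 \<le> \<bar>z\<bar>" "\<bar>z\<bar> \<le> int l" "- z \<notin> A" "- z \<noteq> x"
    "z \<noteq> - x"
    using s(2) unfolding PJ_singular_insert by auto
  then have "z = y \<or> z = - y" using PJ_singular_total[OF s(1) c zz(1,2)] A by auto
  then show ?thesis
  proof
    assume z: "z = - y"
    have sx: "sg (insert (- x) (insert y A))" "sg (insert (- x) (insert z A))"
      using s z A unfolding PJ_singular_insert by auto
    have nx: "- x \<notin> A" "- x \<noteq> y" "- x \<noteq> z" using s unfolding PJ_singular_insert
      by auto
    have v: "insert x A \<in> V" "insert (- x) A \<in> V"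
      using V_insert A nx s sx by (auto simp: PJ_singular_insert)
    show ?thesis
    proof (rule four_cycle)
      show "adj (int k) (f (insert x A)) (f (insert y A))" using f_adj_insert s A by blast
      show "adj (int k) (f (insert y A)) (f (insert (- x) A))"
        using f_adj_insert[OF sx(1)] A nx adj_sym by blast
      show "adj (int k) (f (insert (- x) A)) (f (insert z A))"
        using f_adj_insert[OF sx(2)] A nx by blast
      show "adj (int k) (f (insert z A)) (f (insert x A))"
        using f_adj_insert[OF s(2)] A adj_sym by blast
      show "f (insert x A) \<noteq> f (insert (- x) A)"
        "\<not> adj (int k) (f (insert x A)) (f (insert (- x) A))"
        using f_nonadj[OF v, of x] by auto
      show "int k = int n - 2" using rank_eq l by simp
    qed
  qed simp
qed

section \<open>The Boolean lattice attached to a singular \<open>(m + 2)\<close>-set\<close>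

definition U :: "int set \<Rightarrow> 'a set" where
  "U D = (SOME W. W \<in> G (int k + 1) \<and> (\<forall>x\<in>D. f (D - {x}) \<subseteq> W))"

text \<open>
  For \<open>A = D\<close> the intersection over the empty family is \<open>UNIV\<close>, so that \<open>face D D = U D\<close>.
\<close>

definition face :: "int set \<Rightarrow> int set \<Rightarrow> 'a set" where
  "face D A = U D \<inter> \<Inter>((\<lambda>x. f (D - {x})) ` (D - A))"

lemma U:
  assumes "sg D" "card D = m + 2"
  shows "U D \<in> G (int k + 1)" "x \<in> D \<Longrightarrow> f (D - {x}) \<subseteq> U D"
proof -
  have "\<exists>W. W \<in> G (int k + 1) \<and> (\<forall>x\<in>D. f (D - {x}) \<subseteq> W)"
    using tops assms by blast
  from someI_ex[OF this] show "U D \<in> G (int k + 1)" "x \<in> D \<Longrightarrow>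
    f (D - {x}) \<subseteq> U D"
    unfolding U_def by auto
qed

lemma f_remove_inj: "sg D \<Longrightarrow> card D = m + 2 \<Longrightarrow>
  inj_on (\<lambda>x. f (D - {x})) D"
  using adj_ne[OF f_adj_remove] by (meson inj_on_def)

text \<open>The face is cut out of the \<open>(k + 1)\<close>-dimensional \<open>U D\<close> by
  \<open>m + 2 - card A\<close> independent hyperplanes.\<close>

lemma face_G:
  assumes D: "sg D" "card D = m + 2" and A: "A \<subseteq> D"
  shows "face D A \<in> G (int k - int m - 1 + int (card A))"
proof -
  let ?E = "(\<lambda>x. f (D - {x})) ` (D - A)"
  have fD: "finite D" using PJ_singular_finite D by blast
  have E: "H \<in> G (int k) \<and> H \<subseteq> U D" if "H \<in> ?E" for H
    using that f_G[OF PJ_vertices_remove[OF D]] U(2)[OF D] by auto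
  have ind: "gindep (int k) ?E"
    by (rule geom_independent_subset[OF top_indep[OF D]]) auto
  have "card ?E = card (D - A)"
    by (rule card_image[OF inj_on_subset[OF f_remove_inj[OF D]]]) auto
  then have "int (card ?E) = int m + 2 - int (card A)"
    using D A fD finite_subset[OF A fD] card_mono[OF fD A] by (simp add: card_Diff_subset)
  then have "sdim (face D A) = int k - int m - 1 + int (card A)"
    using dim_indep_top[OF U(1)[OF D] _ E ind] fD by (simp add: face_def)
  moreover have "sing (face D A)"
    unfolding face_def using sing_Int_Inter[OF G_sing[OF U(1)[OF D]], of ?E] E G_sing by blast
  ultimately show ?thesis by (simp add: grass_iff)
qed

lemma face_Int: "face D A \<inter> face D B = face D (A \<inter> B)"
  unfolding face_def by auto

lemma face_mono: "A \<subseteq> B \<Longrightarrow> face D A \<subseteq> face D B"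
  unfolding face_def by auto

lemma face_remove:
  assumes "sg D" "card D = m + 2" "x \<in> D"
  shows "face D (D - {x}) = f (D - {x})"
proof -
  have "D - (D - {x}) = {x}" using assms by auto
  then show ?thesis using U(2)[OF assms] by (auto simp: face_def)
qed

text \<open>Induction downwards from \<open>A = D - {x}\<close>, where both faces are
  \<open>f (D - {x})\<close>. Removing one element \<open>b\<close> is the case settled by
  \<open>star_Int\<close>; any smaller \<open>A\<close> is the intersection of two sets
  \<open>insert b A\<close> and \<open>insert c A\<close> already treated.\<close>

lemma face_swap:
  assumes D: "sg D" "card D = m + 2" "x \<in> D" "y \<notin> D" and D': "sg (insert y (D - {x}))"
  shows "A \<subseteq> D - {x} \<Longrightarrow> face D A = face (insert y (D - {x})) A"
proof (induction "card (D - {x} - A)" arbitrary: A rule: less_induct)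
  case less
  let ?D = "insert y (D - {x})"
  have fD: "finite D" using PJ_singular_finite D by blast
  have c: "card ?D = m + 2" "card (D - {x}) = m + 1" using D fD by auto
  have rem: "?D - {y} = D - {x}" using D by auto
  have base: "face D (D - {x}) = f (D - {x})" "face ?D (D - {x}) = f (D - {x})"
    using face_remove[OF D(1-3)] face_remove[OF D' c(1), of y] rem by auto
  show ?case
  proof (cases "A = D - {x}")
    case True
    then show ?thesis using base by simp
  next
    case False
    then obtain b where b: "b \<in> D" "b \<noteq> x" "b \<notin> A" using less.prems by blast
    show ?thesis
    proof (cases "A = D - {x} - {b}")
      case True
      have e: "insert b A = D - {x}" "insert x A = D - {b}" "insert y A = ?D - {b}"
          "insert b (insert x A) = D" "insert b (insert y A) = ?D"
        using True b D by auto
      have "A = (D - {x}) \<inter> (D - {b})" "A = (D - {x}) \<inter> (?D - {b})" using True D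
        by auto
      then have "face D A = f (D - {x}) \<inter> f (D - {b})"
        "face ?D A = f (D - {x}) \<inter> f (?D - {b})"
        using face_Int[of D "D - {x}" "D - {b}"] face_Int[of ?D "D - {x}" "?D - {b}"]
          face_remove[OF D(1,2) b(1)] face_remove[OF D' c(1), of b] b base by auto
      moreover have "f (insert b A) \<inter> f (insert x A) = f (insert b A) \<inter> f (insert y A)"
      proof (rule star_Int)
        show "card A = m" using True c(2) b fD by simp
      qed (use e D D' b less.prems in auto)
      ultimately show ?thesis using e by simp
    next
      case F: False
      then obtain c where c: "c \<in> D" "c \<noteq> x" "c \<noteq> b" "c \<notin> A"
        using less.prems b by blast
      have lt: "card (D - {x} - insert v A) < card (D - {x} - A)"
        if "v \<in> D" "v \<noteq> x" "v \<notin> A" for v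
        using that fD by (intro psubset_card_mono) auto
      have IH: "face D (insert v A) = face ?D (insert v A)"
        if "v \<in> D" "v \<noteq> x" "v \<notin> A" for v
        using less.hyps[OF lt[OF that]] less.prems that by auto
      have "A = insert b A \<inter> insert c A" using b c by auto
      then show ?thesis
        using face_Int[of D "insert b A" "insert c A"] face_Int[of ?D "insert b A" "insert c A"] IH
          b c by simp
    qed
  qed
qed

lemma face_eq:
  assumes "sg D" "card D = m + 2" "sg D'" "card D' = m + 2" "A \<subseteq> D" "A \<subseteq> D'"
  shows "face D' A = face D A"
proof (rule swap_connected[where R="\<lambda>E. face E A = face D A" and A=A and D=D and c="m+2"])
  fix E x y assume E: "sg E" "card E = m + 2" "A \<subseteq> E - {x}" "x \<in> E" "y \<notin> E"
    "sg (insert y (E - {x}))" "face E A = face D A"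
  then show "face (insert y (E - {x})) A = face D A" using face_swap[of E x y A] by simp
qed (use assms in auto)

text \<open>A form of \<open>face D A\<close> that does not mention \<open>D\<close>. The two agree
  for proper subsets \<open>A\<close> of \<open>D\<close> only: no vertex contains \<open>D\<close>,
  so \<open>flat D\<close> is the whole type.\<close>

definition flat :: "int set \<Rightarrow> 'a set" where
  "flat A = \<Inter>(f ` {B \<in> V. A \<subseteq> B})"

lemma flat_mono: "A \<subseteq> B \<Longrightarrow> flat A \<subseteq> flat B"
  unfolding flat_def by auto

lemma flat_face:
  assumes D: "sg D" "card D = m + 2" and A: "A \<subset> D"
  shows "flat A = face D A"
proof
  obtain x where x: "x \<in> D" "x \<notin> A" using A by blast
  have sub: "flat A \<subseteq> f (D - {y})" if "y \<in> D - A" for y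
    using that A PJ_vertices_remove[OF D] unfolding flat_def by blast
  then show "flat A \<subseteq> face D A" using U(2)[OF D x(1)] x unfolding face_def by blast
  have "face D A \<subseteq> f B" if B: "B \<in> V" "A \<subseteq> B" for B
  proof -
    have fin: "finite B" using B PJ_singular_finite[of l B] by (simp add: V_iff)
    then obtain c where c: "1 \<le> \<bar>c\<bar>" "\<bar>c\<bar> \<le> int l" "c \<notin> B"
      "- c \<notin> B"
      using free_coordinate[of B l] B ml by (auto simp: V_iff)
    let ?D = "insert c B"
    have D': "sg ?D" "card ?D = m + 2" using c B fin by (auto simp: PJ_singular_insert V_iff)
    have "face D A = face ?D A" by (rule face_eq[OF D' D]) (use A B in auto)
    also have "\<dots> \<subseteq> f (?D - {c})" using B c unfolding face_def by blast
    also have "?D - {c} = B" using c by simp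
    finally show ?thesis .
  qed
  then show "face D A \<subseteq> flat A" unfolding flat_def by blast
qed

lemma extend_to_top:
  assumes "sg A" "card A \<le> m + 1"
  shows "\<exists>D. sg D \<and> card D = m + 2 \<and> A \<subset> D"
  using PJ_singular_extend_to[OF assms(1), of "m + 2"] assms(2) ml by force

lemma flat_G:
  assumes "sg A" "card A \<le> m + 1"
  shows "flat A \<in> G (int k - int m - 1 + int (card A))"
proof -
  obtain D where "sg D" "card D = m + 2" "A \<subset> D" using extend_to_top[OF assms] by blast
  then show ?thesis using face_G[of D A] flat_face[of D A] by auto
qed

lemma flat_vertex:
  assumes A: "A \<in> V"
  shows "flat A = f A"
proof -
  have "B = A" if "B \<in> V" "A \<subseteq> B" for B
    using that A card_subset_eq PJ_singular_finite by (metis V_iff)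
  then have "{B \<in> V. A \<subseteq> B} = {A}" using A by blast
  then show ?thesis by (simp add: flat_def)
qed

section \<open>The frame and its apartment\<close>

abbreviation Q :: "int \<Rightarrow> 'a set" where "Q i \<equiv> flat {i}"
abbreviation N :: "'a set" where "N \<equiv> flat {}"
abbreviation J :: "int set" where "J \<equiv> {j. 1 \<le> \<bar>j\<bar> \<and>
  \<bar>j\<bar> \<le> int l}"

lemma sg_single: "i \<in> J \<Longrightarrow> sg {i}"
  by (simp add: PJ_singular_insert PJ_singular_empty)

lemma sg_pair: "i \<in> J \<Longrightarrow> j \<in> J \<Longrightarrow>
  j \<noteq> - i \<Longrightarrow> sg {i, j}"
  by (auto simp: PJ_singular_insert PJ_singular_empty)

lemma N_G: "N \<in> G (int k - int m - 1)"
  using flat_G[OF PJ_singular_empty] by simp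

lemma Q_G: "i \<in> J \<Longrightarrow> Q i \<in> G (int k - int m)"
  using flat_G[OF sg_single] by simp

text \<open>Adding \<open>i\<close> to \<open>A\<close> raises the dimension of the face by one.
  Since \<open>face D {i}\<close> meets \<open>face D A\<close> only in \<open>face D {}\<close>, it
  contains a point outside \<open>face D A\<close>, which together with \<open>face D A\<close>
  spans the larger face.\<close>

lemma face_span:
  assumes D: "sg D" "card D = m + 2"
  shows "finite A \<Longrightarrow> A \<noteq> {} \<Longrightarrow>
    A \<subseteq> D \<Longrightarrow> face D A = span (\<Union>i\<in>A. face D {i})"
proof (induction A rule: finite_ne_induct)
  case (singleton i)
  then show ?case using sing_span_eq[OF G_sing[OF face_G[OF D, of "{i}"]]] by simp
next
  case (insert i A)
  let ?W = "face D (insert i A)" and ?S = "span (\<Union>j\<in>insert i A. face D {j})"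
  have iD: "i \<in> D" "A \<subseteq> D" using insert.prems by auto
  have W: "?W \<in> G (int k - int m - 1 + int (card (insert i A)))"
    using face_G[OF D insert.prems] .
  have Vf: "face D A \<in> G (int k - int m - 1 + int (card A))" using face_G[OF D iD(2)] .
  have i: "face D {i} \<in> G (int k - int m)" using face_G[OF D, of "{i}"] iD by simp
  have e: "face D {} \<in> G (int k - int m - 1)" using face_G[OF D, of "{}"] by simp
  have sub: "\<And>j. j \<in> insert i A \<Longrightarrow> face D {j} \<subseteq> ?W"
    by (rule face_mono) auto
  have "face D {i} \<inter> face D A = face D {}" using face_Int[of D "{i}" A] insert.hyps by simp
  moreover have "face D {i} \<noteq> face D {}" using i e by (auto simp: grass_iff)
  ultimately have "\<not> face D {i} \<subseteq> face D A" by blast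
  then obtain t where t: "t \<in> face D {i}" "t \<notin> face D A" by blast
  have tW: "t \<in> ?W" using t sub by auto
  have dW: "sdim ?W = sdim (face D A) + 1" using W Vf insert.hyps by (simp add: grass_iff)
  have "?W = span (insert t (face D A))"
    using hyperplane_span[OF G_sing[OF Vf] G_sing[OF W] face_mono dW tW t(2)] by auto
  also have "\<dots> \<subseteq> ?S"
  proof (rule geom_span_minimal)
    have "face D A = span (\<Union>j\<in>A. face D {j})" using insert.IH iD by blast
    also have "\<dots> \<subseteq> ?S" by (rule geom_span_mono) auto
    finally have "face D A \<subseteq> ?S" .
    moreover have "t \<in> ?S" using t(1) by blast
    ultimately show "insert t (face D A) \<subseteq> ?S" by blast
  qed
  finally have "?W \<subseteq> ?S" .
  moreover have "?S \<subseteq> ?W" by (rule sing_least[OF G_sing[OF W]]) (use sub in blast)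
  ultimately show ?case by blast
qed

lemma f_span:
  assumes A: "A \<in> V"
  shows "f A = span (\<Union>i\<in>A. Q i)"
proof -
  have a: "sg A" "card A = m + 1" using A by (auto simp: V_iff)
  obtain D where D: "sg D" "card D = m + 2" "A \<subset> D" using extend_to_top[OF a(1)] a(2)
    by auto
  have "A \<noteq> {}" using a by auto
  then have "face D A = span (\<Union>i\<in>A. face D {i})"
    using face_span[OF D(1,2)] PJ_singular_finite[OF a(1)] D by blast
  moreover have "face D {i} = Q i" if "i \<in> A" for i using flat_face[OF D(1,2), of "{i}"] D that
    by blast
  ultimately show ?thesis using flat_face[OF D] flat_vertex[OF A] by simp
qed

abbreviation pcol :: "'a set \<Rightarrow> 'a set \<Rightarrow> bool" where
  "pcol \<equiv> pt_collinear (grass_star P L (int k - int m) N) (star_lines P L (int k - int m) N)"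

lemma Q_star: "i \<in> J \<Longrightarrow> Q i \<in> grass_star P L (int k - int m) N"
  using Q_G flat_mono by (auto simp: grass_star_def)

lemma pcol_collinear_set:
  assumes "pcol S T"
  shows "collinear_set (S \<union> T)"
proof -
  have "S \<in> G (int k - int m)" using assms by (auto simp: pt_collinear_def grass_star_def)
  then have "S = T \<Longrightarrow> ?thesis" using sing_collinear_set G_sing by simp
  moreover have ?thesis if "S \<noteq> T"
  proof -
    have "\<exists>R W. W \<in> G (int k - int m + 1) \<and>
      S \<in> grass_interval P L (int k - int m) R W \<and> T \<in> grass_interval P L (int k - int m) R W"
      using assms that unfolding pt_collinear_def star_lines_def by blast
    then obtain W where "W \<in> G (int k - int m + 1)" "S \<union> T \<subseteq> W"
      unfolding grass_interval_def by blast
    then show ?thesis using collinear_set_mono[OF sing_collinear_set[OF G_sing]] by blast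
  qed
  ultimately show ?thesis by blast
qed

lemma Q_pcol:
  assumes "i \<in> J" "j \<in> J" "j \<noteq> - i"
  shows "pcol (Q i) (Q j)"
proof (cases "i = j")
  case True
  then show ?thesis using Q_star assms by (simp add: pt_collinear_def)
next
  case False
  \<comment> \<open>Here \<open>m > 0\<close> is essential: dimensions of flats are known for at
    most \<open>m + 1\<close> elements.\<close>
  then have W: "flat {i, j} \<in> G (int k - int m + 1)"
    using flat_G[OF sg_pair[OF assms]] m0 by (simp add: add.commute)
  have "grass_interval P L (int k - int m) N (flat {i, j}) \<in> star_lines P L (int k - int m) N"
    unfolding star_lines_def using W N_G flat_mono[of "{}" "{i, j}"] by blast
  moreover have "Q v \<in> grass_interval P L (int k - int m) N (flat {i, j})" if "v \<in> {i, j}"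
    for v
    using that assms Q_G flat_mono[of "{v}" "{i, j}"] flat_mono[of "{}" "{v}"]
      unfolding grass_interval_def by blast
  ultimately show ?thesis using Q_star assms unfolding pt_collinear_def by blast
qed

text \<open>Take a vertex \<open>B\<close> containing \<open>i\<close>, and replace \<open>i\<close>
  by \<open>- i\<close>. If \<open>Q i\<close> and \<open>Q (- i)\<close> were collinear, so would
  be all the subspaces spanning the two images, hence the images themselves. These share the
  \<open>(k - 1)\<close>-dimensional \<open>flat (B - {i})\<close> and would be adjacent, while
  their labels contain opposite elements.\<close>

lemma Q_not_pcol:
  assumes i: "i \<in> J"
  shows "\<not> pcol (Q i) (Q (- i))"
proof
  assume "pcol (Q i) (Q (- i))"
  then have cl: "collinear_set (Q i \<union> Q (- i))" by (rule pcol_collinear_set)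
  obtain B where B: "{i} \<subseteq> B" "sg B" "card B = m + 1"
    using PJ_singular_extend_to[OF sg_single[OF i], of "m + 1"] ml by auto
  let ?A = "B - {i}"
  have fB: "finite B" using PJ_singular_finite B by blast
  have A: "card ?A = m" "sg ?A" "i \<notin> ?A" "- i \<notin> ?A" "- i \<notin> B"
    using B fB PJ_singular_subset[OF B(2), of ?A] PJ_singular_neg[OF B(2), of i "- i"] by auto
  have v: "B \<in> V" "insert (- i) ?A \<in> V"
    using B V_insert[of "- i" ?A] A i by (auto simp: V_iff PJ_singular_insert)
  have subJ: "B \<subseteq> J" "insert (- i) ?A \<subseteq> J" using v
    by (auto simp: V_iff PJ_singular_def)
  have QP: "Q a \<subseteq> P" if "a \<in> J" for a using sing_P[OF G_sing[OF Q_G[OF that]]] .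
  have c: "col p q" if "a \<in> B" "b \<in> insert (- i) ?A" "p \<in> Q a" "q \<in> Q b" for a b p q
  proof (cases "b = - a")
    case True
    have "a = i"
    proof (rule ccontr)
      assume "a \<noteq> i"
      then have "b \<in> ?A" using True that by auto
      then show False using PJ_singular_neg[OF B(2), of b a] True that by auto
    qed
    then show ?thesis using cl that True by (auto simp: collinear_set_def)
  next
    case False
    then have "collinear_set (Q a \<union> Q b)" using pcol_collinear_set[OF Q_pcol] that subJ
      by blast
    then show ?thesis using that by (auto simp: collinear_set_def)
  qed
  have "col p q" if "p \<in> f B" "q \<in> f (insert (- i) ?A)" for p q
  proof (rule col_span2)
    show "p \<in> span (\<Union>a\<in>B. Q a)" "q \<in> span (\<Union>b\<in>insert (- i) ?A. Q b)"
      using that f_span[OF v(1)] f_span[OF v(2)] by auto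
    show "(\<Union>a\<in>B. Q a) \<subseteq> P" "(\<Union>b\<in>insert (- i) ?A. Q b) \<subseteq> P"
      using QP subJ by blast+
  qed (use c in blast)
  then have clf: "collinear_set (f B \<union> f (insert (- i) ?A))"
    using collinear_set_Un G_sing f_G v by blast
  have na: "\<not> adj (int k) (f B) (f (insert (- i) ?A))" "f B \<noteq> f (insert (- i) ?A)"
    using f_nonadj[OF v, of i] B by auto
  have "flat ?A \<in> G (int k - 1)" using flat_G[OF A(2)] A(1) by simp
  moreover have "flat ?A \<subseteq> f B" "flat ?A \<subseteq> f (insert (- i) ?A)"
    using flat_mono[of ?A] flat_vertex v by (metis Diff_subset, metis subset_insertI)
  ultimately show False using in_star(1)[OF f_G[OF v(1)] f_G[OF v(2)] na(2)] clf na(1) by blast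
qed

lemma Q_inj: "inj_on Q J"
proof (rule inj_onI, rule ccontr)
  fix i j assume ij: "i \<in> J" "j \<in> J" "Q i = Q j" "i \<noteq> j"
  show False
  proof (cases "j = - i")
    case True
    then show False using Q_not_pcol[OF ij(1)] Q_star[OF ij(1)] ij by (simp add: pt_collinear_def)
  next
    case False
    then have s: "sg {i, j}" "card {i, j} \<le> m + 1" using sg_pair ij m0 by auto
    obtain D where D: "sg D" "card D = m + 2" "{i, j} \<subset> D" using extend_to_top[OF s] by auto
    have "face D {i} \<inter> face D {j} = face D {}" using face_Int[of D "{i}" "{j}"] ij by simp
    moreover have "face D {i} = Q i" "face D {j} = Q j" "face D {} = N"
      using flat_face[OF D(1,2), of "{i}"] flat_face[OF D(1,2), of "{j}"]
        flat_face[OF D(1,2), of "{}"] D by auto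
    ultimately have "Q i = N" using ij by simp
    then show False using Q_G[OF ij(1)] N_G by (simp add: grass_iff)
  qed
qed

lemma card_J: "finite J" "card J = 2 * l"
proof -
  have e: "J = {1..int l} \<union> {- int l..- 1}" by auto
  show "finite J" unfolding e by simp
  have "card ({1..int l} \<union> {- int l..- 1}) = card {1..int l} + card {- int l..- 1}"
    by (rule card_Un_disjoint) auto
  then show "card J = 2 * l" unfolding e by simp
qed

lemma apartment: "parabolic_apartment P L n k m N (f ` V)"
proof -
  let ?QQ = "grass_star P L (int k - int m) N" and ?RR = "star_lines P L (int k - int m) N"
  \<comment> \<open>The subtraction is not truncated, since \<open>l + k = n + m\<close> and
    \<open>m + 2 \<le> l\<close> give \<open>k \<le> n\<close>.\<close>
  have nk: "n - k + m = l" using rank_eq ml by linarith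
  have uJ: "- i \<in> J" if "i \<in> J" for i using that by simp
  have pc: "pcol (Q i) (Q j) \<longleftrightarrow> j \<noteq> - i" if "i \<in> J" "j \<in> J"
    for i j
    using Q_pcol Q_not_pcol that by blast
  have "polar_frame ?QQ ?RR (n - k + m) (Q ` J)"
    unfolding polar_frame_def nk
  proof (intro conjI ballI)
    show "Q ` J \<subseteq> ?QQ" using Q_star by blast
    show "finite (Q ` J)" using card_J by simp
    show "card (Q ` J) = 2 * l" using card_image[OF Q_inj] card_J by simp
    fix p assume "p \<in> Q ` J"
    then obtain i where i: "i \<in> J" "p = Q i" by blast
    have ne: "Q (- i) \<noteq> Q i" using inj_onD[OF Q_inj, of "- i" i] i uJ by auto
    show "\<exists>!q. q \<in> Q ` J \<and> q \<noteq> p \<and> \<not> pcol p q"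
    proof (rule ex1I[of _ "Q (- i)"])
      show "Q (- i) \<in> Q ` J \<and> Q (- i) \<noteq> p \<and> \<not> pcol p (Q (- i))"
        using i ne pc[OF i(1) uJ[OF i(1)]] uJ by blast
      show "q = Q (- i)" if "q \<in> Q ` J \<and> q \<noteq> p \<and> \<not> pcol p q" for q
        using that pc i by blast
    qed
  qed
  moreover have "f ` V = {Y \<in> G (int k). \<exists>C. C \<subseteq> Q ` J \<and> card C = m + 1 \<and>
      (\<forall>S\<in>C. \<forall>T\<in>C. pcol S T) \<and> Y = span (\<Union>C)}" (is "_ = ?R")
  proof
    show "f ` V \<subseteq> ?R"
    proof
      fix Y assume "Y \<in> f ` V"
      then obtain A where A: "A \<in> V" "Y = f A" by blast
      have AJ: "A \<subseteq> J" using A by (auto simp: V_iff PJ_singular_def)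
      have "card (Q ` A) = m + 1" using card_image[OF inj_on_subset[OF Q_inj AJ]] A
        by (simp add: V_iff)
      moreover have "pcol (Q i) (Q j)" if "i \<in> A" "j \<in> A" for i j
        using that pc AJ A PJ_singular_neg[of l A j i] by (auto simp: V_iff)
      ultimately show "Y \<in> ?R" using f_G[OF A(1)] f_span[OF A(1)] A(2) AJ
        by (auto intro!: exI[of _ "Q ` A"])
    qed
    show "?R \<subseteq> f ` V"
    proof
      fix Y assume "Y \<in> ?R"
      then obtain C where C: "C \<subseteq> Q ` J" "card C = m + 1"
        "\<forall>S\<in>C. \<forall>T\<in>C. pcol S T" "Y = span (\<Union>C)" by blast
      \<comment> \<open>By injectivity of \<open>Q\<close> on \<open>J\<close>, the size of
        \<open>C\<close> is that of \<open>A\<close>; mutual collinearity of \<open>C\<close> says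
        that \<open>A\<close> has no opposite elements, which makes \<open>A\<close> a
        vertex.\<close>
      then obtain A where A: "A \<subseteq> J" "C = Q ` A" by (meson subset_imageE)
      have "card A = m + 1" using card_image[OF inj_on_subset[OF Q_inj A(1)]] C A by simp
      moreover have "sg A"
        unfolding PJ_singular_def using A C(3) pc by blast
      ultimately have "A \<in> V" by (simp add: V_iff)
      then show "Y \<in> f ` V" using f_span C(4) A(2) by blast
    qed
  qed
  ultimately show ?thesis unfolding parabolic_apartment_def Let_def by blast
qed

end

theorem theorem4p2:
  fixes P :: "'a set" and L :: "'a set set" and n k l m :: nat and X :: "'a set set"
  assumes "polar_space_of_rank P L n" and "n \<ge> 3"
    and "0 < m" and "m \<le> k" and "l \<le> n"
    and "int l - int m = int n - int k" and "int n - int k > 1"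
    and "X \<subseteq> polar_grass P L (int k)"
    and "graph_isomorphic X (grass_adj P L (int k)) (PJ_vertices l m) (PJ_adj l m)"
    and "\<And>C. maximal_clique X (grass_adj P L (int k)) C \<Longrightarrow>
           geom_independent (polar_grass P L (int k)) (grass_lines P L (int k)) C"
    and "2 * m + 2 > l \<or>
         \<not> (\<exists>S \<in> polar_grass P L (int k - 1). X \<subseteq> grass_star P L (int k) S)"
  shows "\<exists>N \<in> polar_grass P L (int k - int m - 1). parabolic_apartment P L n k m N X"
proof -
  let ?V = "PJ_vertices l m"
  obtain g where g: "bij_betw g X ?V"
    and gE: "\<And>x y. x \<in> X \<Longrightarrow> y \<in> X \<Longrightarrow>
      grass_adj P L (int k) x y \<longleftrightarrow> PJ_adj l m (g x) (g y)"
    using assms(9) unfolding graph_isomorphic_def by blast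
  define f where "f = inv_into X g"
  have f: "bij_betw f ?V X" unfolding f_def by (rule bij_betw_inv_into[OF g])
  have fX: "f A \<in> X" if "A \<in> ?V" for A using f that by (auto simp: bij_betw_def)
  have gf: "g (f A) = A" if "A \<in> ?V" for A
    using bij_betw_inv_into_right[OF g that] by (simp add: f_def)
  have fE: "PJ_adj l m A B \<longleftrightarrow> grass_adj P L (int k) (f A) (f B)"
    if "A \<in> ?V" "B \<in> ?V" for A B
    using gE[OF fX fX] gf that by simp
  have emb: "PJ_embedding P L n k l m f"
  proof
    show "polar_space_of_rank P L n" "0 < m" by (rule assms)+
    show "m + 2 \<le> l" "l + k = n + m" using assms(6,7) by linarith+
    show "f A \<in> polar_grass P L (int k)" if "A \<in> ?V" for A using fX that assms(8) by blast
    show "inj_on f ?V" using f by (simp add: bij_betw_def)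
    show "grass_adj P L (int k) (f A) (f B) \<longleftrightarrow> PJ_adj l m A B"
      if "A \<in> ?V" "B \<in> ?V" for A B
      using fE that by simp
    show "geom_independent (polar_grass P L (int k)) (grass_lines P L (int k)) (f ` C)"
      if "maximal_clique ?V (PJ_adj l m) C" for C
      using assms(10) maximal_clique_image[OF f fE that] by blast
  qed
  have Xf: "X = f ` ?V" using f by (simp add: bij_betw_def)
  have "l < 2 * m + 2 \<or> \<not> (\<exists>S\<in>polar_grass P L (int k - 1). \<forall>A\<in>?V. S \<subseteq> f A)"
    using assms(8,11) Xf unfolding grass_star_def by fastforce
  from PJ_embedding.good_embedding[OF emb this] obtain h
    where h: "PJ_embedding P L n k l m h" "h ` ?V = f ` ?V"
    "\<forall>D. PJ_singular l D \<longrightarrow> card D = m + 2 \<longrightarrow>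
      (\<exists>W\<in>polar_grass P L (int k + 1). \<forall>x\<in>D. h (D - {x}) \<subseteq> W)"
    by (elim exE conjE)
  have "PJ_top_embedding P L n k l m h"
    unfolding PJ_top_embedding_def PJ_top_embedding_axioms_def using h by blast
  then interpret PJ_top_embedding P L n k l m h .
  \<comment> \<open>The apartment is obtained for \<open>h\<close>, whose image is still
    \<open>X\<close>.\<close>
  show ?thesis using N_G apartment h(2) Xf by metis
qed

end
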